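(* For every subgroup $K\le\mathbb Q/\mathbb Z$ there is an embedding (injective group homomorphism) $F\wr_r K\hookrightarrow T$, where $F$ and $T$ are R. Thompson's groups.
   Context: For groups $C,S$, $C\wr_r S\cong\left(\bigoplus_{s\in S}C\right)\rtimes S$ denotes the restricted standard wreath product. Thompson's group $F$ (respectively $T$) is the group of orientation-preserving piecewise-linear homeomorphisms (with finitely many breakpoints) of the interval $I=[0,1]$ (respectively of the circle $\mathbb R/\mathbb Z$) such that all slopes are integral powers of two, all changes of slope occur at dyadic rationals, and dyadic rationals are mapped to dyadic rationals. *)

theory Defs
  imports
    "HOL-Analysis.Analysis"
    "HOL-Algebra.Bij"
    "HOL-Algebra.Product_Groups"
begin

section \<open>Restricted standard wreath products\<close>

definition semidirect_product ::
    "('a, 'm) monoid_scheme \<Rightarrow> ('b, 'n) monoid_scheme \<Rightarrow> ('b \<Rightarrow> 'a \<Rightarrow> 'a) \<Rightarrow> ('a \<times> 'b) monoid"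
  where "semidirect_product N H \<phi> =
    \<lparr>carrier = carrier N \<times> carrier H,
     mult = \<lambda>(n, h) (n', h'). (n \<otimes>\<^bsub>N\<^esub> \<phi> h n', h \<otimes>\<^bsub>H\<^esub> h'),
     one = (\<one>\<^bsub>N\<^esub>, \<one>\<^bsub>H\<^esub>)\<rparr>"

text \<open>The left regular action of \<open>S\<close> on the coordinates; the inverse makes it a left action.\<close>

definition shift_action :: "('b, 'n) monoid_scheme \<Rightarrow> 'b \<Rightarrow> ('b \<Rightarrow> 'a) \<Rightarrow> ('b \<Rightarrow> 'a)"
  where "shift_action S s x = (\<lambda>t\<in>carrier S. x (inv\<^bsub>S\<^esub> s \<otimes>\<^bsub>S\<^esub> t))"

definition restricted_wreath ::
    "('a, 'm) monoid_scheme \<Rightarrow> ('b, 'n) monoid_scheme \<Rightarrow> (('b \<Rightarrow> 'a) \<times> 'b) monoid"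
  where "restricted_wreath C S =
    semidirect_product (sum_group (carrier S) (\<lambda>_. C)) S (shift_action S)"

lemma shift_action_closed:
  assumes C: "group C" and S: "group S" and s: "s \<in> carrier S"
    and x: "x \<in> carrier (sum_group (carrier S) (\<lambda>_. C))"
  shows "shift_action S s x \<in> carrier (sum_group (carrier S) (\<lambda>_. C))"
proof -
  interpret S: group S by (rule S)
  have "{t \<in> carrier S. shift_action S s x t \<noteq> \<one>\<^bsub>C\<^esub>} \<subseteq>
      (\<lambda>t. s \<otimes>\<^bsub>S\<^esub> t) ` {t \<in> carrier S. x t \<noteq> \<one>\<^bsub>C\<^esub>}"
  proof
    fix t assume t: "t \<in> {t \<in> carrier S. shift_action S s x t \<noteq> \<one>\<^bsub>C\<^esub>}"
    then have "t = s \<otimes>\<^bsub>S\<^esub> (inv\<^bsub>S\<^esub> s \<otimes>\<^bsub>S\<^esub> t)"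
      using s by (simp flip: S.m_assoc)
    then show "t \<in> (\<lambda>t. s \<otimes>\<^bsub>S\<^esub> t) ` {t \<in> carrier S. x t \<noteq> \<one>\<^bsub>C\<^esub>}"
      using t s by (auto simp: shift_action_def)
  qed
  moreover have "finite {t \<in> carrier S. x t \<noteq> \<one>\<^bsub>C\<^esub>}"
    using x C by (simp add: carrier_sum_group)
  ultimately have "finite {t \<in> carrier S. shift_action S s x t \<noteq> \<one>\<^bsub>C\<^esub>}"
    by (meson finite_imageI finite_subset)
  then show ?thesis
    using x C s by (auto simp: carrier_sum_group shift_action_def PiE_iff)
qed

lemma group_restricted_wreath:
  assumes C: "group C" and S: "group S"
  shows "group (restricted_wreath C S)"
proof -
  interpret C: group C by (rule C)
  interpret S: group S by (rule S)
  let ?N = "sum_group (carrier S) (\<lambda>_. C)"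
  interpret N: group ?N by (simp add: C)
  have app: "x t \<in> carrier C" if "x \<in> carrier ?N" "t \<in> carrier S" for x t
    using that by (auto simp: carrier_sum_group C)
  have ext: "x t = undefined" if "x \<in> carrier ?N" "t \<notin> carrier S" for x t
    using that by (auto simp: carrier_sum_group C PiE_iff extensional_def)
  show ?thesis
  proof (rule groupI)
    fix p q r
    assume "p \<in> carrier (restricted_wreath C S)" "q \<in> carrier (restricted_wreath C S)"
      "r \<in> carrier (restricted_wreath C S)"
    then show "p \<otimes>\<^bsub>restricted_wreath C S\<^esub> q \<otimes>\<^bsub>restricted_wreath C S\<^esub> r =
        p \<otimes>\<^bsub>restricted_wreath C S\<^esub> (q \<otimes>\<^bsub>restricted_wreath C S\<^esub> r)"
      by (auto simp: restricted_wreath_def semidirect_product_def shift_action_def app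
          S.m_assoc C.m_assoc S.inv_mult_group fun_eq_iff)
  next
    fix p assume "p \<in> carrier (restricted_wreath C S)"
    then show "\<one>\<^bsub>restricted_wreath C S\<^esub> \<otimes>\<^bsub>restricted_wreath C S\<^esub> p = p"
      by (auto simp: restricted_wreath_def semidirect_product_def shift_action_def app ext
          fun_eq_iff)
  next
    fix p assume p: "p \<in> carrier (restricted_wreath C S)"
    obtain x s where ps: "p = (x, s)" by fastforce
    with p have x: "x \<in> carrier ?N" and s: "s \<in> carrier S"
      by (auto simp: restricted_wreath_def semidirect_product_def)
    let ?q = "(shift_action S (inv\<^bsub>S\<^esub> s) (inv\<^bsub>?N\<^esub> x), inv\<^bsub>S\<^esub> s)"
    have "?q \<in> carrier (restricted_wreath C S)"
      using shift_action_closed[OF C S, of "inv\<^bsub>S\<^esub> s" "inv\<^bsub>?N\<^esub> x"] N.inv_closed[OF x] s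
      by (simp add: restricted_wreath_def semidirect_product_def)
    moreover have "?q \<otimes>\<^bsub>restricted_wreath C S\<^esub> p = \<one>\<^bsub>restricted_wreath C S\<^esub>"
      using x s by (auto simp: ps restricted_wreath_def semidirect_product_def shift_action_def
          app C fun_eq_iff)
    ultimately show "\<exists>q\<in>carrier (restricted_wreath C S).
        q \<otimes>\<^bsub>restricted_wreath C S\<^esub> p = \<one>\<^bsub>restricted_wreath C S\<^esub>" by blast
  qed (use shift_action_closed[OF C S] N.m_closed in
      \<open>auto simp: restricted_wreath_def semidirect_product_def N.one_closed[simplified]
        simp del: mult_sum_group one_sum_group\<close>)
qed

section \<open>The groups \<open>\<rat>/\<int>\<close> and \<open>\<real>/\<int>\<close>\<close>

definition additive_group :: "'a::ab_group_add monoid"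
  where "additive_group = \<lparr>carrier = UNIV, mult = (+), one = 0\<rparr>"

definition rat_mod_int :: "rat set monoid"
  where "rat_mod_int = additive_group Mod \<int>"

definition real_mod_int :: "real set monoid"
  where "real_mod_int = additive_group Mod \<int>"

definition circle_proj :: "real \<Rightarrow> real set"
  where "circle_proj x = \<int> #>\<^bsub>additive_group\<^esub> x"

text \<open>The quotient topology on \<open>\<real>/\<int>\<close>.\<close>

definition circle_topology :: "real set topology"
  where "circle_topology =
    topology (\<lambda>U. U \<subseteq> carrier real_mod_int \<and> open (circle_proj -` U))"

lemma group_additive_group: "group (additive_group :: 'a::ab_group_add monoid)"
  by (rule groupI) (auto simp: additive_group_def add.assoc intro: exI[of _ "- x" for x])

lemma normal_Ints_additive_group: "(\<int> :: 'a::ring_1 set) \<lhd> additive_group"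
proof -
  interpret group "additive_group :: 'a monoid" by (rule group_additive_group)
  have inv: "inv\<^bsub>additive_group\<^esub> x = - x" for x :: 'a
    by (rule inv_equality) (auto simp: additive_group_def)
  have "subgroup (\<int> :: 'a set) additive_group"
    by (rule subgroupI) (auto simp: inv, auto simp: additive_group_def)
  moreover have "comm_group (additive_group :: 'a monoid)"
    by (rule group_comm_groupI) (auto simp: additive_group_def add.commute)
  ultimately show ?thesis by (simp add: comm_group.normal_iff_subgroup)
qed

lemma group_rat_mod_int: "group rat_mod_int"
  unfolding rat_mod_int_def by (rule normal.factorgroup_is_group[OF normal_Ints_additive_group])

lemma carrier_real_mod_int: "carrier real_mod_int = range circle_proj"
  by (auto simp: real_mod_int_def FactGroup_def RCOSETS_def circle_proj_def additive_group_def)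

lemma openin_circle_topology:
  "openin circle_topology U \<longleftrightarrow> U \<subseteq> carrier real_mod_int \<and> open (circle_proj -` U)"
proof -
  have "istopology (\<lambda>U. U \<subseteq> carrier real_mod_int \<and> open (circle_proj -` U))"
    unfolding istopology_def by (auto simp: vimage_Union)
  then show ?thesis by (simp add: circle_topology_def)
qed

lemma topspace_circle_topology: "topspace circle_topology = carrier real_mod_int"
proof -
  have "openin circle_topology (carrier real_mod_int)"
    by (simp add: openin_circle_topology carrier_real_mod_int vimage_def)
  then show ?thesis
    by (meson openin_circle_topology openin_subset openin_topspace subset_antisym)
qed

lemma quotient_map_circle_proj: "quotient_map euclidean circle_topology circle_proj"
  by (auto simp: quotient_map_def topspace_circle_topology carrier_real_mod_int
      openin_circle_topology vimage_def)

section \<open>Thompson's groups\<close>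

definition dyadics :: "real set"
  where "dyadics = {of_int m / 2 ^ n | (m::int) (n::nat). True}"

definition affine_pow2_on :: "real set \<Rightarrow> (real \<Rightarrow> real) \<Rightarrow> bool"
  where "affine_pow2_on A f \<longleftrightarrow> (\<exists>(n::int) c. \<forall>x\<in>A. f x = 2 powi n * x + c)"

text \<open>\<open>B\<close> is a finite set of dyadic points containing all breakpoints.\<close>

definition thompson_F :: "(real \<Rightarrow> real) monoid"
  where "thompson_F = BijGroup {0..1} \<lparr>carrier :=
    {f \<in> Bij {0..1}.
       homeomorphic_map (top_of_set {0..1}) (top_of_set {0..1}) f \<and>
       strict_mono_on {0..1} f \<and>
       (\<exists>B. finite B \<and> B \<subseteq> dyadics \<and>
          (\<forall>a b. {a<..<b} \<subseteq> {0..1} - B \<longrightarrow> affine_pow2_on {a<..<b} f)) \<and>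
       f ` (dyadics \<inter> {0..1}) \<subseteq> dyadics}\<rparr>"

text \<open>
  Orientation and slopes of a circle map \<open>f\<close> are those of a lift \<open>g\<close> of \<open>f\<close> to \<open>\<real>\<close>; the
  breakpoints are points of the circle, so that finiteness is finiteness modulo \<open>\<int>\<close>.
\<close>

definition thompson_T :: "(real set \<Rightarrow> real set) monoid"
  where "thompson_T = BijGroup (carrier real_mod_int) \<lparr>carrier :=
    {f \<in> Bij (carrier real_mod_int).
       homeomorphic_map circle_topology circle_topology f \<and>
       (\<exists>g. continuous_on UNIV g \<and> strict_mono g \<and>
          (\<forall>x. f (circle_proj x) = circle_proj (g x)) \<and>
          (\<exists>B. finite B \<and> B \<subseteq> circle_proj ` dyadics \<and>
             (\<forall>a b. circle_proj ` {a<..<b} \<inter> B = {} \<longrightarrow> affine_pow2_on {a<..<b} g))) \<and>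
       f ` (circle_proj ` dyadics) \<subseteq> circle_proj ` dyadics}\<rparr>"

end

theory Submission
  imports Defs
begin

text \<open>
  Let \<open>\<Phi>\<^sub>n\<close> (\<open>uniformize n\<close> below) be a piecewise linear dyadic homeomorphism of the line with
  \<open>\<Phi>\<^sub>n (x + 1) = \<Phi>\<^sub>n x + n!\<close>. Conjugating the translation by \<open>q n!\<close> with \<open>\<Phi>\<^sub>n\<close>
  makes \<open>q \<in> (1/n!)\<int>\<close> act on the line, with \<open>1\<close> acting as translation by \<open>1\<close>. These actions fit
  together to an action of \<open>\<rat>\<close> when
  \<open>\<Phi>\<^sub>n\<^sub>+\<^sub>1 = \<psi>\<^sub>n \<circ> \<Phi>\<^sub>n\<close> with \<open>\<psi>\<^sub>n (x + 1) = \<psi>\<^sub>n x + (n + 1)\<close>. If moreover every \<open>\<psi>\<^sub>n\<close>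
  fixes \<open>[0, 1/2]\<close> pointwise, the translates of \<open>[0, 1/2)\<close> under \<open>\<rat>\<close> are pairwise disjoint.
  Hence \<open>\<rat>/\<int>\<close> acts on the circle by elements of \<open>T\<close> with a wandering interval, and a
  copy of \<open>F\<close> supported on that interval generates the wreath product together with \<open>K\<close>.
\<close>

section \<open>Piecewise linear homeomorphisms of the line\<close>

lemma dyadics_of_int [simp]: "of_int k \<in> dyadics"
proof -
  have "of_int k = (of_int k :: real) / 2 ^ 0" by simp
  then show ?thesis unfolding dyadics_def by blast
qed

lemma dyadics_0 [simp]: "0 \<in> dyadics" and dyadics_1 [simp]: "1 \<in> dyadics"
  using dyadics_of_int[of 0] dyadics_of_int[of 1] by auto

lemma dyadics_add [simp]: "x + y \<in> dyadics" if xy: "x \<in> dyadics" "y \<in> dyadics"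
proof -
  obtain a k b l where "x = of_int a / 2 ^ k" "y = of_int b / 2 ^ l"
    using xy unfolding dyadics_def by blast
  then have "x + y = of_int (a * 2 ^ l + b * 2 ^ k) / 2 ^ (k + l)"
    by (simp add: power_add add_divide_distrib)
  then show ?thesis unfolding dyadics_def by blast
qed

lemma dyadics_minus [simp]: "- x \<in> dyadics" if xy: "x \<in> dyadics"
proof -
  obtain a k where "x = of_int a / 2 ^ k" using xy unfolding dyadics_def by blast
  then have "- x = of_int (- a) / 2 ^ k" by simp
  then show ?thesis unfolding dyadics_def by blast
qed

lemma dyadics_diff [simp]: "x - y \<in> dyadics" if "x \<in> dyadics" "y \<in> dyadics"
  using dyadics_add[of x "- y"] that by simp

lemma dyadics_powi [simp]: "2 powi n * x \<in> dyadics" if xy: "x \<in> dyadics"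
proof -
  obtain a k where x: "x = of_int a / 2 ^ k" using xy unfolding dyadics_def by blast
  show ?thesis
  proof (cases "n \<ge> 0")
    case True
    then have "2 powi n * x = of_int (a * 2 ^ nat n) / 2 ^ k"
      by (simp add: x power_int_def)
    then show ?thesis unfolding dyadics_def by blast
  next
    case False
    then have "2 powi n * x = of_int a / 2 ^ (k + nat (- n))"
      by (simp add: x power_int_def power_add field_simps)
    then show ?thesis unfolding dyadics_def by blast
  qed
qed

lemma dyadics_powi_iff [simp]: "2 powi n * x \<in> dyadics \<longleftrightarrow> x \<in> dyadics"
proof
  assume "2 powi n * x \<in> dyadics"
  then have "2 powi (- n) * (2 powi n * x) \<in> dyadics" by (rule dyadics_powi)
  then show "x \<in> dyadics" by (simp add: power_int_minus flip: mult.assoc)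
qed simp

lemma dyadics_add_iff: "c \<in> dyadics \<Longrightarrow> x + c \<in> dyadics \<longleftrightarrow> x \<in> dyadics"
  using dyadics_diff[of "x + c" c] by auto

lemma dyadics_half [simp]: "1 / 2 \<in> dyadics"
  using dyadics_powi[of 1 "-1"] by (simp add: power_int_def)

lemma dyadics_dense:
  assumes "a < b"
  obtains x where "x \<in> dyadics" "a < x" "x < b"
proof -
  obtain n :: nat where "1 / (b - a) < 2 ^ n"
    using real_arch_pow[of 2] by auto
  then have n: "1 < (b - a) * 2 ^ n"
    using assms by (simp add: field_simps)
  \<comment> \<open>The numerator of the first multiple of \<open>1 / 2 ^ n\<close> strictly beyond
    \<open>a\<close>; the mesh is already smaller than \<open>b - a\<close>.\<close>
  define k where "k = \<lfloor>a * 2 ^ n\<rfloor> + 1"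
  have "a * 2 ^ n < of_int k" "of_int k \<le> a * 2 ^ n + 1"
    unfolding k_def by linarith+
  moreover have "a * 2 ^ n + 1 < b * 2 ^ n" using n by (simp add: algebra_simps)
  ultimately have "a < of_int k / 2 ^ n" "of_int k / 2 ^ n < b"
    by (auto simp: field_simps)
  then show thesis using that unfolding dyadics_def by blast
qed

section \<open>One-sided affine germs and local piecewise linearity\<close>

text \<open>The side of the germ is \<open>s = 1\<close> (right) or \<open>s = - 1\<close> (left).\<close>

definition affine_germ :: "(real \<Rightarrow> real) \<Rightarrow> real \<Rightarrow> real \<Rightarrow> int \<Rightarrow> real \<Rightarrow> bool"
  where "affine_germ f x s m c \<longleftrightarrow> c \<in> dyadics \<and>
    (\<exists>e>0. \<forall>t. 0 \<le> t \<and> t < e \<longrightarrow> f (x + s * t) = 2 powi m * (x + s * t) + c)"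

text \<open>A purely local condition replaces a global set of breakpoints, so that composition,
  inversion and gluing are checked one germ at a time. A kink is allowed only at a dyadic point;
  finiteness of the breakpoints on bounded intervals comes back by compactness in
  \<open>locally_PL_breakpoints\<close>.\<close>

definition locally_PL :: "(real \<Rightarrow> real) \<Rightarrow> real \<Rightarrow> bool"
  where "locally_PL f x \<longleftrightarrow> (\<exists>m c n d. affine_germ f x 1 m c \<and> affine_germ f x (- 1) n d \<and>
    (x \<in> dyadics \<or> m = n \<and> c = d))"

definition PL_homeos :: "(real \<Rightarrow> real) set"
  where "PL_homeos = {f. bij f \<and> (\<forall>x. locally_PL f x)}"

lemma affine_germ_value:
  assumes "affine_germ f x s m c"
  shows "f x = 2 powi m * x + c"
proof -
  obtain e where e: "e > 0" "\<And>t. 0 \<le> t \<and> t < e \<Longrightarrow> f (x + s * t) = 2 powi m * (x + s * t) + c"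
    using assms unfolding affine_germ_def by blast
  from e(2)[of 0] e(1) show ?thesis by simp
qed

text \<open>Multiplying by a power of two and adding a dyadic intercept both preserve and reflect
  dyadicity. Hence the germs alone control where dyadic points go.\<close>

lemma affine_germ_dyadic_iff:
  assumes "affine_germ f x s m c"
  shows "f x \<in> dyadics \<longleftrightarrow> x \<in> dyadics"
  using assms affine_germ_value[OF assms] by (simp add: dyadics_add_iff affine_germ_def)

lemma affine_germ_cong:
  assumes "affine_germ f x s m c" "e > 0"
    and "\<And>t. 0 \<le> t \<Longrightarrow> t < e \<Longrightarrow> g (x + s * t) = f (x + s * t)"
  shows "affine_germ g x s m c"
proof -
  obtain d where "d > 0" "\<forall>t. 0 \<le> t \<and> t < d \<longrightarrow> f (x + s * t) = 2 powi m * (x + s * t) + c"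
    using assms(1) by (auto simp: affine_germ_def)
  with assms show ?thesis
    unfolding affine_germ_def by (intro conjI exI[of _ "min d e"]) auto
qed

lemma affine_germI:
  assumes "c \<in> dyadics" "\<And>y. f y = 2 powi m * y + c"
  shows "affine_germ f x s m c"
  using assms by (auto simp: affine_germ_def intro: exI[of _ 1])

text \<open>Slopes are positive, so \<open>f\<close> keeps the side \<open>s\<close>, and the germ
  of \<open>g\<close> at \<open>f x\<close> on that same side is the one that matters.\<close>

lemma affine_germ_compose:
  assumes f: "affine_germ f x s m c" and g: "affine_germ g (f x) s n d"
  shows "affine_germ (g \<circ> f) x s (n + m) (2 powi n * c + d)"
proof -
  obtain e where e: "e > 0" "\<And>t. 0 \<le> t \<Longrightarrow> t < e \<Longrightarrow> f (x + s * t) = 2 powi m * (x + s * t) + c"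
    using f by (auto simp: affine_germ_def)
  obtain e' where e': "e' > 0"
    "\<And>t. 0 \<le> t \<Longrightarrow> t < e' \<Longrightarrow> g (f x + s * t) = 2 powi n * (f x + s * t) + d"
    using g by (auto simp: affine_germ_def)
  \<comment> \<open>The radius \<open>e' / 2 powi m\<close> keeps the stretched displacement
    \<open>2 powi m * t\<close> within the range where \<open>g\<close> is affine.\<close>
  have "(g \<circ> f) (x + s * t) = 2 powi (n + m) * (x + s * t) + (2 powi n * c + d)"
    if "0 \<le> t" "t < min e (e' / 2 powi m)" for t
  proof -
    have "f (x + s * t) = f x + s * (2 powi m * t)"
      using e(2)[of t] that by (simp add: affine_germ_value[OF f] algebra_simps)
    moreover have "2 powi m * t < e'" using that by (simp add: field_simps)
    ultimately have "(g \<circ> f) (x + s * t) = 2 powi n * (f x + s * (2 powi m * t)) + d"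
      using e'(2)[of "2 powi m * t"] that by simp
    then show ?thesis by (simp add: affine_germ_value[OF f] power_int_add algebra_simps)
  qed
  then show ?thesis
    using f g e(1) e'(1) unfolding affine_germ_def
    by (intro conjI exI[of _ "min e (e' / 2 powi m)"]) auto
qed

lemma affine_germ_inv:
  assumes f: "affine_germ f x s m c" and "inj f"
  shows "affine_germ (inv_into UNIV f) (f x) s (- m) (- (2 powi (- m) * c))"
proof -
  obtain e where e: "e > 0" "\<And>t. 0 \<le> t \<Longrightarrow> t < e \<Longrightarrow> f (x + s * t) = 2 powi m * (x + s * t) + c"
    using f by (auto simp: affine_germ_def)
  have "inv_into UNIV f (f x + s * t) = 2 powi (- m) * (f x + s * t) + - (2 powi (- m) * c)"
    if "0 \<le> t" "t < 2 powi m * e" for t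
  proof -
    define u where "u = t / 2 powi m"
    have "0 \<le> u" "u < e" using that by (auto simp: u_def field_simps)
    then have "f (x + s * u) = f x + s * (2 powi m * u)"
      using e(2)[of u] by (simp add: affine_germ_value[OF f] algebra_simps)
    then have "f (x + s * u) = f x + s * t" by (simp add: u_def)
    then have "inv_into UNIV f (f x + s * t) = x + s * u" using \<open>inj f\<close> by (metis inv_f_f)
    also have "\<dots> = 2 powi (- m) * (f x + s * t) + - (2 powi (- m) * c)"
      by (simp add: affine_germ_value[OF f] u_def power_int_minus field_simps)
    finally show ?thesis .
  qed
  then show ?thesis
    using f e(1) unfolding affine_germ_def
    by (intro conjI exI[of _ "2 powi m * e"]) auto
qed

lemma affine_germ_of_ball:
  assumes "c \<in> dyadics" "e > 0" "\<And>y. \<bar>y - x\<bar> < e \<Longrightarrow> f y = 2 powi m * y + c" "\<bar>s\<bar> = 1"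
  shows "affine_germ f x s m c"
  using assms unfolding affine_germ_def by (auto intro!: exI[of _ e] simp: abs_mult)

lemma locally_PLE:
  assumes "locally_PL f x"
  obtains m c n d e where "c \<in> dyadics" "d \<in> dyadics" "e > 0"
    "\<And>y. x \<le> y \<Longrightarrow> y < x + e \<Longrightarrow> f y = 2 powi m * y + c"
    "\<And>y. x - e < y \<Longrightarrow> y \<le> x \<Longrightarrow> f y = 2 powi n * y + d"
    "x \<in> dyadics \<or> m = n \<and> c = d"
proof -
  obtain m c n d where a: "affine_germ f x 1 m c" "affine_germ f x (- 1) n d"
    "x \<in> dyadics \<or> m = n \<and> c = d"
    using assms by (auto simp: locally_PL_def)
  obtain e where e: "e > 0" "\<And>t. 0 \<le> t \<Longrightarrow> t < e \<Longrightarrow> f (x + t) = 2 powi m * (x + t) + c"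
    using a(1) by (auto simp: affine_germ_def)
  obtain e' where e': "e' > 0" "\<And>t. 0 \<le> t \<Longrightarrow> t < e' \<Longrightarrow> f (x - t) = 2 powi n * (x - t) + d"
    using a(2) by (auto simp: affine_germ_def)
  have "f y = 2 powi m * y + c" if "x \<le> y" "y < x + min e e'" for y
    using e(2)[of "y - x"] that by simp
  moreover have "f y = 2 powi n * y + d" if "x - min e e' < y" "y \<le> x" for y
    using e'(2)[of "x - y"] that by simp
  ultimately show thesis
    using that[of c d "min e e'" m n] a e(1) e'(1) by (auto simp: affine_germ_def)
qed

lemma locally_PL_cong:
  assumes "locally_PL f x" "e > 0" "\<And>y. \<bar>y - x\<bar> < e \<Longrightarrow> g y = f y"
  shows "locally_PL g x"
proof -
  have *: "affine_germ g x s m c" if "affine_germ f x s m c" "\<bar>s\<bar> = 1" for s m c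
    using affine_germ_cong[OF that(1) assms(2), of g] assms(3) that(2) by (simp add: abs_mult)
  then have "affine_germ g x 1 m c" if "affine_germ f x 1 m c" for m c
    using that by simp
  moreover have "affine_germ g x (- 1) m c" if "affine_germ f x (- 1) m c" for m c
    using * that by simp
  ultimately show ?thesis using assms(1) unfolding locally_PL_def by blast
qed

text \<open>The two germs may have different slopes, which is allowed because \<open>x\<close> is
  dyadic. Both equations for \<open>h\<close> cover \<open>y = x\<close>, so the pieces meet
  there.\<close>

lemma locally_PL_glue:
  assumes "locally_PL f x" "locally_PL g x" "x \<in> dyadics" "e > 0"
    and "\<And>y. x \<le> y \<Longrightarrow> y < x + e \<Longrightarrow> h y = f y"
    and "\<And>y. x - e < y \<Longrightarrow> y \<le> x \<Longrightarrow> h y = g y"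
  shows "locally_PL h x"
proof -
  obtain m c where "affine_germ f x 1 m c" using assms(1) by (auto simp: locally_PL_def)
  then have "affine_germ h x 1 m c"
    using assms(4,5) by (rule_tac affine_germ_cong[of f x 1 m c e]) auto
  moreover obtain n d where "affine_germ g x (- 1) n d"
    using assms(2) by (auto simp: locally_PL_def)
  then have "affine_germ h x (- 1) n d"
    using assms(4,6) by (rule_tac affine_germ_cong[of g x "- 1" n d e]) auto
  ultimately show ?thesis using assms(3) by (auto simp: locally_PL_def)
qed

lemma locally_PL_affine:
  assumes "c \<in> dyadics" "\<And>y. f y = 2 powi m * y + c"
  shows "locally_PL f x"
  using assms affine_germI unfolding locally_PL_def by blast

lemma locally_PL_id [simp]: "locally_PL (\<lambda>x. x) x"
  by (rule locally_PL_affine[of 0 _ 0]) auto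

text \<open>A kink of \<open>g\<close> at \<open>f x\<close> forces \<open>f x\<close> to be dyadic,
  and then \<open>x\<close> is dyadic by \<open>affine_germ_dyadic_iff\<close>; so kinks of the
  composite are again at dyadic points.\<close>

lemma locally_PL_compose:
  assumes "locally_PL f x" "locally_PL g (f x)"
  shows "locally_PL (g \<circ> f) x"
proof -
  obtain m c n d where f: "affine_germ f x 1 m c" "affine_germ f x (- 1) n d"
    "x \<in> dyadics \<or> m = n \<and> c = d"
    using assms(1) by (auto simp: locally_PL_def)
  obtain m' c' n' d' where g: "affine_germ g (f x) 1 m' c'" "affine_germ g (f x) (- 1) n' d'"
    "f x \<in> dyadics \<or> m' = n' \<and> c' = d'"
    using assms(2) by (auto simp: locally_PL_def)
  show ?thesis
    using affine_germ_compose[OF f(1) g(1)] affine_germ_compose[OF f(2) g(2)] f(3) g(3)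
      affine_germ_dyadic_iff[OF f(1)]
    unfolding locally_PL_def by metis
qed

lemma locally_PL_inv:
  assumes "locally_PL f x" "inj f"
  shows "locally_PL (inv_into UNIV f) (f x)"
proof -
  obtain m c n d where f: "affine_germ f x 1 m c" "affine_germ f x (- 1) n d"
    "x \<in> dyadics \<or> m = n \<and> c = d"
    using assms(1) by (auto simp: locally_PL_def)
  show ?thesis
    using affine_germ_inv[OF f(1) assms(2)] affine_germ_inv[OF f(2) assms(2)] f(3)
      affine_germ_dyadic_iff[OF f(1)]
    unfolding locally_PL_def by metis
qed

section \<open>The group of dyadic PL homeomorphisms of the line\<close>

lemma PL_homeosI: "bij f \<Longrightarrow> (\<And>x. locally_PL f x) \<Longrightarrow> f \<in> PL_homeos"
  by (auto simp: PL_homeos_def)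

lemma PL_homeosD: "f \<in> PL_homeos \<Longrightarrow> bij f" "f \<in> PL_homeos \<Longrightarrow> locally_PL f x"
  by (auto simp: PL_homeos_def)

lemma PL_id: "(\<lambda>x. x) \<in> PL_homeos" "id \<in> PL_homeos"
  using locally_PL_id by (auto simp: PL_homeos_def id_def bij_id[unfolded id_def])

lemma PL_compose: "f \<in> PL_homeos \<Longrightarrow> g \<in> PL_homeos \<Longrightarrow> g \<circ> f \<in> PL_homeos"
  by (auto simp: PL_homeos_def locally_PL_compose intro: bij_comp)

lemma PL_inv: "f \<in> PL_homeos \<Longrightarrow> inv_into UNIV f \<in> PL_homeos"
proof (rule PL_homeosI)
  fix x assume f: "f \<in> PL_homeos"
  then have "x = f (inv_into UNIV f x)" by (simp add: PL_homeosD(1) bij_is_surj surj_f_inv_f)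
  then show "locally_PL (inv_into UNIV f) x"
    using locally_PL_inv[of f "inv_into UNIV f x"] f by (simp add: PL_homeosD bij_is_inj)
qed (simp add: PL_homeosD(1) bij_imp_bij_inv)

lemma PL_affine: "(\<lambda>x. 2 powi m * x + c) \<in> PL_homeos" if "c \<in> dyadics"
  using that by (intro PL_homeosI locally_PL_affine[of c _ m])
    (auto intro!: bij_betw_byWitness[where f' = "\<lambda>x. (x - c) / 2 powi m"])

lemma PL_translation: "(\<lambda>x. x + c) \<in> PL_homeos" if "c \<in> dyadics"
  using PL_affine[OF that, of 0] by simp

lemma PL_double: "(\<lambda>x. 2 * x) \<in> PL_homeos"
  using PL_affine[of 0 1] by simp

lemma PL_half: "(\<lambda>x. x / 2) \<in> PL_homeos"
  using PL_affine[of 0 "- 1"] by (simp add: power_int_minus field_simps)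

section \<open>Continuity and monotonicity\<close>

lemma locally_PL_imp_isCont:
  assumes "locally_PL f x"
  shows "isCont f x"
proof -
  obtain m c n d e where e: "e > 0"
    "\<And>y. x \<le> y \<Longrightarrow> y < x + e \<Longrightarrow> f y = 2 powi m * y + c"
    "\<And>y. x - e < y \<Longrightarrow> y \<le> x \<Longrightarrow> f y = 2 powi n * y + d"
    using locally_PLE[OF assms] by metis
  have "((\<lambda>y. 2 powi m * y + c) \<longlongrightarrow> 2 powi m * x + c) (at_right x)"
    by (intro tendsto_intros)
  moreover have "eventually (\<lambda>y. 2 powi m * y + c = f y) (at_right x)"
    using eventually_at_right_less eventually_at_right_real[of x "x + e"] e
    by (auto elim!: eventually_mono)
  ultimately have R: "(f \<longlongrightarrow> f x) (at_right x)"
    using e(2)[of x] e(1) by (auto dest: Lim_transform_eventually)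
  have "((\<lambda>y. 2 powi n * y + d) \<longlongrightarrow> 2 powi n * x + d) (at_left x)"
    by (intro tendsto_intros)
  moreover have "eventually (\<lambda>y. 2 powi n * y + d = f y) (at_left x)"
    using eventually_at_left_real[of "x - e" x] e
    by (auto elim!: eventually_mono)
  ultimately have "(f \<longlongrightarrow> f x) (at_left x)"
    using e(3)[of x] e(1) by (auto dest: Lim_transform_eventually)
  with R show ?thesis by (simp add: isCont_def filterlim_at_split)
qed

lemma PL_continuous_on: "f \<in> PL_homeos \<Longrightarrow> continuous_on A f"
  by (simp add: PL_homeosD continuous_at_imp_continuous_on locally_PL_imp_isCont)

text \<open>Positive slopes make \<open>f\<close> increase across every point on a small scale;
  \<open>Bolzano\<close> induction chains these short intervals together.\<close>

lemma locally_PL_imp_strict_mono: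
  assumes "\<And>x. locally_PL f x"
  shows "strict_mono f"
proof (rule strict_monoI)
  fix a b :: real assume "a < b"
  then have "a \<le> b" by simp
  \<comment> \<open>The implication makes the property true of degenerate intervals, which the
    induction also visits.\<close>
  then have "a < b \<longrightarrow> f a < f b"
  proof (induction a b rule: Bolzano)
    case (trans a b c)
    then show ?case by (cases "a = b"; cases "b = c") auto
  next
    case (local x)
    obtain m c n d e where e: "e > 0"
      "\<And>y. x \<le> y \<Longrightarrow> y < x + e \<Longrightarrow> f y = 2 powi m * y + c"
      "\<And>y. x - e < y \<Longrightarrow> y \<le> x \<Longrightarrow> f y = 2 powi n * y + d"
      using locally_PLE[OF assms] by metis
    have up: "f x < f y" if "x < y" "y < x + e" for y
      using e(2)[of x] e(2)[of y] that e(1) by simp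
    have down: "f y < f x" if "x - e < y" "y < x" for y
      using e(3)[of x] e(3)[of y] that e(1) by simp
    have "f a < f b" if "a \<le> x" "x \<le> b" "b - a < e" "a < b" for a b
      using up[of b] down[of a] that by (cases "a = x"; cases "b = x") auto
    then show ?case using e(1) by blast
  qed
  with \<open>a < b\<close> show "f a < f b" by simp
qed

lemma PL_strict_mono: "f \<in> PL_homeos \<Longrightarrow> strict_mono f"
  by (rule locally_PL_imp_strict_mono) (rule PL_homeosD)

lemma PL_dyadic_iff: "f \<in> PL_homeos \<Longrightarrow> f x \<in> dyadics \<longleftrightarrow> x \<in> dyadics"
  using PL_homeosD(2)[of f x] affine_germ_dyadic_iff unfolding locally_PL_def by blast

section \<open>Affine pieces and finiteness of breakpoints\<close>

definition affine_near :: "(real \<Rightarrow> real) \<Rightarrow> real \<Rightarrow> int \<Rightarrow> real \<Rightarrow> bool"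
  where "affine_near f x m c \<longleftrightarrow> (\<exists>e>0. \<forall>y. \<bar>y - x\<bar> < e \<longrightarrow> f y = 2 powi m * y + c)"

text \<open>Two points of the common ball, \<open>x\<close> and \<open>x + u\<close>, determine
  slope and intercept. This makes the parameters of overlapping pieces agree.\<close>

lemma affine_near_unique:
  assumes "affine_near f x m c" "affine_near f x n d"
  shows "m = n \<and> c = d"
proof -
  obtain e where e: "e > 0" "\<And>y. \<bar>y - x\<bar> < e \<Longrightarrow> f y = 2 powi m * y + c"
    using assms(1) by (auto simp: affine_near_def)
  obtain e' where e': "e' > 0" "\<And>y. \<bar>y - x\<bar> < e' \<Longrightarrow> f y = 2 powi n * y + d"
    using assms(2) by (auto simp: affine_near_def)
  define u where "u = min e e' / 2"
  have u: "u > 0" "u < e" "u < e'" using e(1) e'(1) by (auto simp: u_def min_def)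
  have 1: "2 powi m * x + c = 2 powi n * x + d" using e(2)[of x] e'(2)[of x] e(1) e'(1) by simp
  have "2 powi m * (x + u) + c = 2 powi n * (x + u) + d"
    using e(2)[of "x + u"] e'(2)[of "x + u"] u by simp
  with 1 have "(2::real) powi m * u = 2 powi n * u"
    unfolding distrib_left by linarith
  then have "(2::real) powi m = 2 powi n" using u by simp
  then have "m = n"
    using power_int_strict_increasing[of m n "2::real"] power_int_strict_increasing[of n m "2::real"]
    by (cases m n rule: linorder_cases) auto
  with 1 show ?thesis by simp
qed

text \<open>The parameters \<open>m\<close> and \<open>c\<close> are locally constant, hence
  constant on a connected set. \<open>Bolzano\<close> gives this on compact subintervals; every
  point is then compared with the midpoint.\<close>

lemma affine_near_interval:
  assumes "\<And>x. a < x \<Longrightarrow> x < b \<Longrightarrow> \<exists>m c. affine_near f x m c"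
  shows "affine_pow2_on {a<..<b} f"
proof (cases "a < b")
  case True
  have chain: "\<exists>m c. \<forall>x\<in>{u..v}. affine_near f x m c" if "a < u" "u \<le> v" "v < b" for u v
  proof -
    have "a < u \<and> v < b \<longrightarrow> (\<exists>m c. \<forall>x\<in>{u..v}. affine_near f x m c)"
      using that(2)
    proof (induction u v rule: Bolzano)
      case (trans u v w)
      show ?case
      proof
        assume "a < u \<and> w < b"
        with trans have "a < u \<and> v < b" "a < v \<and> w < b" by auto
        with trans obtain m c n d where *: "\<forall>x\<in>{u..v}. affine_near f x m c"
          "\<forall>x\<in>{v..w}. affine_near f x n d"
          by blast
        moreover have "v \<in> {u..v}" "v \<in> {v..w}" using trans by auto
        ultimately have "m = n \<and> c = d" using affine_near_unique by blast
        with * have "affine_near f x m c" if "x \<in> {u..w}" for x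
          using that by (cases "x \<le> v") auto
        then show "\<exists>m c. \<forall>x\<in>{u..w}. affine_near f x m c" by blast
      qed
    next
      case (local x)
      show ?case
      proof (cases "a < x \<and> x < b")
        case True
        then obtain m c e where e: "e > 0" "\<And>y. \<bar>y - x\<bar> < e \<Longrightarrow> f y = 2 powi m * y + c"
          using assms[of x] by (auto simp: affine_near_def)
        have "affine_near f z m c" if "\<bar>z - x\<bar> < e" for z
          unfolding affine_near_def using that e
          by (intro exI[of _ "e - \<bar>z - x\<bar>"]) auto
        then have "\<forall>z\<in>{u..v}. affine_near f z m c" if "u \<le> x" "x \<le> v" "v - u < e" for u v
          using that by auto
        with e(1) show ?thesis by blast
      next
        case False
        \<comment> \<open>If \<open>x\<close> lies outside the open interval, no \<open>u\<close>
          and \<open>v\<close> around \<open>x\<close> satisfy \<open>a < u\<close> and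
          \<open>v < b\<close>, so the claim is vacuous and any radius serves.\<close>
        then show ?thesis by (intro exI[of _ 1]) auto
      qed
    qed
    with that show ?thesis by simp
  qed
  define z where "z = (a + b) / 2"
  have z: "a < z" "z < b" using True by (auto simp: z_def)
  obtain m c where mc: "affine_near f z m c" using assms z by blast
  have "f y = 2 powi m * y + c" if "a < y" "y < b" for y
  proof -
    have "\<exists>n d. \<forall>x\<in>{min y z..max y z}. affine_near f x n d"
      using that z by (intro chain) auto
    then obtain n d where *: "\<forall>x\<in>{min y z..max y z}. affine_near f x n d" by blast
    then have "affine_near f z n d" "affine_near f y n d" by auto
    with mc have "affine_near f y m c" using affine_near_unique by blast
    then show ?thesis by (auto simp: affine_near_def)
  qed
  then show ?thesis by (auto simp: affine_pow2_on_def)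
qed (auto simp: affine_pow2_on_def)

text \<open>Near each point only the point itself can be a breakpoint, and only if it is dyadic;
  compactness leaves finitely many.\<close>

lemma locally_PL_breakpoints:
  assumes "\<And>x. locally_PL f x" "a \<le> b"
  obtains B where "finite B" "B \<subseteq> dyadics" "\<And>x. x \<in> {a..b} - B \<Longrightarrow> \<exists>m c. affine_near f x m c"
proof -
  have "\<exists>B. finite B \<and> B \<subseteq> dyadics \<and> (\<forall>x\<in>{a..b} - B. \<exists>m c. affine_near f x m c)"
    using assms(2)
  proof (induction a b rule: Bolzano)
    case (trans a b c)
    then obtain A B where "finite A" "A \<subseteq> dyadics" "\<forall>x\<in>{a..b} - A. \<exists>m c. affine_near f x m c"
      "finite B" "B \<subseteq> dyadics" "\<forall>x\<in>{b..c} - B. \<exists>m c. affine_near f x m c"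
      by blast
    then show ?case by (intro exI[of _ "A \<union> B"]) force
  next
    case (local x)
    obtain m c n d e where e: "c \<in> dyadics" "d \<in> dyadics" "e > 0"
      "\<And>y. x \<le> y \<Longrightarrow> y < x + e \<Longrightarrow> f y = 2 powi m * y + c"
      "\<And>y. x - e < y \<Longrightarrow> y \<le> x \<Longrightarrow> f y = 2 powi n * y + d"
      "x \<in> dyadics \<or> m = n \<and> c = d"
      using locally_PLE[OF assms(1)] by metis
    have right: "affine_near f y m c" if "x < y" "y < x + e" for y
      unfolding affine_near_def using that e
      by (intro exI[of _ "min (y - x) (x + e - y)"]) auto
    have left: "affine_near f y n d" if "x - e < y" "y < x" for y
      unfolding affine_near_def using that e
      by (intro exI[of _ "min (x - y) (y - (x - e))"]) auto
    \<comment> \<open>Away from the dyadics the left and right germs coincide, so \<open>x\<close>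
      itself is no breakpoint.\<close>
    have mid: "affine_near f x m c" if "x \<notin> dyadics"
      unfolding affine_near_def using that e
      by (intro exI[of _ e]) (metis abs_less_iff add.commute diff_less_eq linear minus_diff_eq)
    have "\<exists>m c. affine_near f y m c" if "\<bar>y - x\<bar> < e" "y \<notin> {x} \<inter> dyadics" for y
      using right[of y] left[of y] mid that by (cases y x rule: linorder_cases) fastforce+
    note * = this
    have "\<forall>y\<in>{a..b} - {x} \<inter> dyadics. \<exists>m c. affine_near f y m c"
      if "a \<le> x" "x \<le> b" "b - a < e" for a b
    proof
      fix y assume "y \<in> {a..b} - {x} \<inter> dyadics"
      with that have "\<bar>y - x\<bar> < e" "y \<notin> {x} \<inter> dyadics" by auto
      then show "\<exists>m c. affine_near f y m c" by (rule *)
    qed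
    then show ?case using e(3)
      by (intro exI[of _ e] conjI allI impI exI[of _ "{x} \<inter> dyadics"]) auto
  qed
  with that show thesis by blast
qed

section \<open>Gluing two homeomorphisms at a dyadic point\<close>

lemma PL_glue:
  assumes f: "f \<in> PL_homeos" and g: "g \<in> PL_homeos" and a: "a \<in> dyadics" and eq: "f a = g a"
  shows "(\<lambda>x. if x \<le> a then f x else g x) \<in> PL_homeos" (is "?h \<in> _")
proof (rule PL_homeosI)
  show l: "locally_PL ?h x" for x
  proof (cases x a rule: linorder_cases)
    case less
    then show ?thesis
      using f by (intro locally_PL_cong[of f x "a - x" ?h]) (auto simp: PL_homeosD)
  next
    case equal
    then show ?thesis
      using f g a eq by (intro locally_PL_glue[of g x f 1 ?h]) (auto simp: PL_homeosD)
  next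
    case greater
    then show ?thesis
      using g by (intro locally_PL_cong[of g x "x - a" ?h]) (auto simp: PL_homeosD)
  qed
  \<comment> \<open>The common value \<open>f a = g a\<close> decides which branch hits
    \<open>y\<close>. Injectivity will follow from the local property through strict
    monotonicity.\<close>
  have "\<exists>x. y = ?h x" for y
  proof (cases "y \<le> f a")
    case True
    obtain x where x: "y = f x" using f PL_homeosD(1) bij_is_surj surjD by metis
    then have "x \<le> a" using True PL_strict_mono[OF f] by (simp add: strict_mono_less_eq)
    with x show ?thesis by auto
  next
    case False
    obtain x where x: "y = g x" using g PL_homeosD(1) bij_is_surj surjD by metis
    then have "a < x" using False PL_strict_mono[OF g] eq by (simp add: strict_mono_less_eq)
    with x show ?thesis by (intro exI[of _ x]) auto
  qed
  then have "surj ?h" unfolding surj_def by (rule allI)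
  moreover have "strict_mono ?h" using l by (rule locally_PL_imp_strict_mono)
  then have "inj ?h" by (rule strict_mono_imp_inj_on)
  ultimately show "bij ?h" by (simp add: bij_def)
qed

section \<open>Thompson's group F\<close>

text \<open>Thompson's group F as maps of the whole line supported in the unit interval; composition
  and inverse become those of total functions.\<close>

definition unit_PL :: "(real \<Rightarrow> real) set"
  where "unit_PL = {g \<in> PL_homeos. \<forall>x. x \<le> 0 \<or> 1 \<le> x \<longrightarrow> g x = x}"

text \<open>Elements of \<open>thompson_F\<close> are \<open>undefined\<close> off the interval;
  this replaces the default by the identity and so undoes \<open>restrict\<close>.\<close>

definition extend_id :: "(real \<Rightarrow> real) \<Rightarrow> real \<Rightarrow> real"
  where "extend_id f x = (if x \<in> {0..1} then f x else x)"

lemma unit_PL_image: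
  assumes "g \<in> unit_PL"
  shows "g x \<in> {0..1} \<longleftrightarrow> x \<in> {0..1}"
proof -
  have "strict_mono g" and g: "g 0 = 0" "g 1 = 1"
    using assms by (auto simp: unit_PL_def PL_strict_mono)
  then show ?thesis using strict_mono_less_eq[of g 0 x] strict_mono_less_eq[of g x 1] by simp
qed

lemma unit_PL_bij_betw: "g \<in> unit_PL \<Longrightarrow> bij_betw g {0..1} {0..1}"
proof -
  assume g: "g \<in> unit_PL"
  then have bij: "bij g" by (simp add: unit_PL_def PL_homeosD)
  have "y \<in> g ` {0..1}" if "y \<in> {0..1}" for y
  proof -
    obtain x where "y = g x" using bij bij_is_surj surjD by metis
    with that unit_PL_image[OF g] show ?thesis by blast
  qed
  then show "bij_betw g {0..1} {0..1}"
    using unit_PL_image[OF g] inj_on_subset[OF bij_is_inj[OF bij]]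
    unfolding bij_betw_def by blast
qed

lemma unit_PL_compose: "f \<in> unit_PL \<Longrightarrow> g \<in> unit_PL \<Longrightarrow> f \<circ> g \<in> unit_PL"
  by (auto simp: unit_PL_def PL_compose)

lemma unit_PL_inv:
  assumes "f \<in> unit_PL"
  shows "inv_into UNIV f \<in> unit_PL"
proof -
  have "inj f" using assms by (simp add: unit_PL_def PL_homeosD bij_is_inj)
  then have "inv_into UNIV f x = x" if "x \<le> 0 \<or> 1 \<le> x" for x
    using assms that by (intro inv_f_eq) (auto simp: unit_PL_def)
  then show ?thesis using assms by (auto simp: unit_PL_def PL_inv)
qed

lemma restrict_unit_PL_in_F:
  assumes g: "g \<in> unit_PL"
  shows "restrict g {0..1} \<in> carrier thompson_F"
proof -
  have PL: "g \<in> PL_homeos" using g by (simp add: unit_PL_def)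
  note bij = unit_PL_bij_betw[OF g]
  let ?f = "restrict g {0..1}"
  have "bij_betw ?f {0..1} {0..1}"
    using bij by (rule bij_betw_cong[THEN iffD1, rotated]) simp
  then have Bij: "?f \<in> Bij {0..1}" by (simp add: Bij_def)
  have "continuous_on {0..1} ?f"
    using PL_continuous_on[OF PL] by (rule continuous_on_eq) simp
  then have homeo: "homeomorphic_map (top_of_set {0..1}) (top_of_set {0..1}) ?f"
    using bij by (intro continuous_imp_homeomorphic_map)
      (auto simp: continuous_map_subtopology_eu bij_betw_def compact_space_subtopology
        Hausdorff_space_subtopology)
  have mono: "strict_mono_on {0..1} ?f"
    using PL_strict_mono[OF PL] by (auto simp: strict_mono_on_def strict_mono_def)
  obtain B where B: "finite B" "B \<subseteq> dyadics"
    "\<And>x. x \<in> {0..1} - B \<Longrightarrow> \<exists>m c. affine_near g x m c"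
    using locally_PL_breakpoints[of g 0 1] PL by (auto simp: PL_homeosD)
  have "affine_pow2_on {a<..<b} ?f" if *: "{a<..<b} \<subseteq> {0..1} - B" for a b
  proof -
    have "affine_pow2_on {a<..<b} g"
      using * B(3) by (intro affine_near_interval) (auto simp: subset_iff)
    then show ?thesis
      using * unfolding affine_pow2_on_def by (auto simp: subset_iff)
  qed
  moreover have "?f ` (dyadics \<inter> {0..1}) \<subseteq> dyadics"
    using PL_dyadic_iff[OF PL] by auto
  ultimately show ?thesis
    using Bij homeo mono B unfolding thompson_F_def by auto
qed

text \<open>\<open>affine_pow2_on\<close> leaves the intercept free. A dyadic point of the interval
  has a dyadic image, and solving for \<open>c\<close> there shows that \<open>c\<close> is
  dyadic.\<close>

lemma dyadic_affine:
  assumes "affine_pow2_on {a<..<b} f" "a < b" "{a<..<b} \<subseteq> {0..1}"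
    and "f ` (dyadics \<inter> {0..1}) \<subseteq> dyadics"
  obtains m c where "c \<in> dyadics" "\<And>x. a < x \<Longrightarrow> x < b \<Longrightarrow> f x = 2 powi m * x + c"
proof -
  obtain m c where mc: "\<forall>x\<in>{a<..<b}. f x = 2 powi m * x + c"
    using assms(1) by (auto simp: affine_pow2_on_def)
  obtain z where z: "z \<in> dyadics" "a < z" "z < b" using dyadics_dense[OF assms(2)] .
  then have "f z \<in> dyadics" using assms(3,4) by (auto simp: subset_iff)
  moreover have "c = f z - 2 powi m * z" using mc z by simp
  ultimately have "c \<in> dyadics" using z by simp
  with mc that show thesis by auto
qed

lemma finite_gap:
  fixes x :: real
  assumes "finite B" "e > 0"
  obtains d where "0 < d" "d \<le> e" "\<And>y. y \<in> B \<Longrightarrow> \<bar>y - x\<bar> < d \<Longrightarrow> y = x"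
proof -
  \<comment> \<open>Inserting \<open>e\<close> keeps the set nonempty and bounds the gap by
    \<open>e\<close>.\<close>
  define d where "d = Min (insert e ((\<lambda>y. \<bar>y - x\<bar>) ` (B - {x})))"
  have "d \<le> e" "d > 0" using assms by (auto simp: d_def)
  moreover have "d \<le> \<bar>y - x\<bar>" if "y \<in> B" "y \<noteq> x" for y
    using assms that by (auto simp: d_def)
  ultimately show thesis using that by force
qed

text \<open>Close to a point and on one side of it there are no elements of \<open>B\<close>, so
  \<open>f\<close> is affine there, and continuity carries the formula to the point itself. At 0 and
  1 the outer germ is the identity.\<close>

lemma extend_F_in_unit_PL:
  assumes "f \<in> carrier thompson_F"
  shows "extend_id f \<in> unit_PL"
proof -
  have bij: "bij_betw f {0..1} {0..1}" and mono: "strict_mono_on {0..1} f"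
    and homeo: "homeomorphic_map (top_of_set {0..1}) (top_of_set {0..1}) f"
    and dy: "f ` (dyadics \<inter> {0..1}) \<subseteq> dyadics"
    using assms by (auto simp: thompson_F_def Bij_def)
  obtain B where B: "finite B" "B \<subseteq> dyadics"
    "\<And>a b. {a<..<b} \<subseteq> {0..1} - B \<Longrightarrow> affine_pow2_on {a<..<b} f"
    using assms unfolding thompson_F_def by auto
  have cont: "continuous_on {0..1} f"
    using homeomorphic_imp_continuous_map[OF homeo] by (simp add: continuous_map_subtopology_eu)
  have into: "f x \<in> {0..1}" if "x \<in> {0..1}" for x using bij that by (auto simp: bij_betw_def)
  have f0: "f 0 = 0"
  proof -
    obtain z where z: "z \<in> {0..1}" "f z = 0" using bij unfolding bij_betw_def
      by (metis atLeastAtMost_iff imageE order_refl zero_le_one)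
    show ?thesis
      using strict_mono_onD[OF mono, of 0 z] z into[of 0] by (cases "z = 0") auto
  qed
  have f1: "f 1 = 1"
  proof -
    obtain z where z: "z \<in> {0..1}" "f z = 1" using bij unfolding bij_betw_def
      by (metis atLeastAtMost_iff imageE order_refl zero_le_one)
    show ?thesis
      using strict_mono_onD[OF mono, of z 1] z into[of 1] by (cases "z = 1") auto
  qed
  let ?g = "extend_id f"
  have out: "?g x = x" if "x \<le> 0 \<or> 1 \<le> x" for x
    using that f0 f1 by (cases "x = 0"; cases "x = 1") (auto simp: extend_id_def)
  have "bij_betw ?g {0..1} {0..1}"
    using bij by (rule bij_betw_cong[THEN iffD1, rotated]) (simp add: extend_id_def)
  moreover have "bij_betw ?g (- {0..1}) (- {0..1})"
    by (rule bij_betw_byWitness[where f' = id]) (auto simp: extend_id_def)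
  ultimately have "bij_betw ?g ({0..1} \<union> - {0..1}) ({0..1} \<union> - {0..1})"
    by (rule bij_betw_combine) auto
  then have bijg: "bij ?g" by simp
  have side: "\<exists>m c. affine_germ ?g x s m c"
    if x: "x \<in> {0..1}" and s: "\<bar>s\<bar> = 1" and e0: "e > 0" "\<And>t. 0 \<le> t \<Longrightarrow> t < e \<Longrightarrow> x + s * t \<in> {0..1}" for x s e
  proof -
    obtain d where d: "0 < d" "d \<le> e" "\<And>y. y \<in> B \<Longrightarrow> \<bar>y - x\<bar> < d \<Longrightarrow> y = x"
      using finite_gap[OF B(1) e0(1)] by blast
    \<comment> \<open>For either sign of \<open>s\<close> this is the open interval between
      \<open>x\<close> and \<open>x + s * d\<close>, which misses \<open>B\<close>.\<close>
    define a b where "a = min x (x + s * d)" and "b = max x (x + s * d)"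
    have s': "s = 1 \<or> s = - 1" using s by auto
    have ab: "y \<in> {a<..<b} \<longleftrightarrow> (\<exists>t. 0 < t \<and> t < d \<and> y = x + s * t)" for y
      using s' d(1) by (auto simp: a_def b_def intro: exI[of _ "y - x"] exI[of _ "x - y"])
    then have in_ab: "x + s * t \<in> {a<..<b}" if "0 < t" "t < d" for t
      using that by blast
    have sub: "{a<..<b} \<subseteq> {0..1} - B"
    proof
      fix y assume "y \<in> {a<..<b}"
      then obtain t where t: "0 < t" "t < d" "y = x + s * t" using ab by blast
      then have "y \<in> {0..1}" "\<bar>y - x\<bar> < d" "y \<noteq> x" using e0(2)[of t] d s' by auto
      then show "y \<in> {0..1} - B" using d(3) by auto
    qed
    have "a < b" "{a<..<b} \<subseteq> {0..1}" using sub d s' by (auto simp: a_def b_def)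
    then obtain m c where mc: "c \<in> dyadics" "\<And>y. y \<in> {a<..<b} \<Longrightarrow> f y = 2 powi m * y + c"
      using dyadic_affine[OF B(3)[OF sub] _ _ dy] by (metis greaterThanLessThan_iff)
    \<comment> \<open>The deviation from the affine formula vanishes for small positive
      \<open>t\<close>, hence also at \<open>t = 0\<close> by continuity.\<close>
    define g where "g t = f (x + s * t) - (2 powi m * (x + s * t) + c)" for t
    have "continuous_on {0..d / 2} (\<lambda>t. f (x + s * t))"
      using e0(2) d by (intro continuous_on_compose2[OF cont]) (auto intro!: continuous_intros)
    then have "continuous_on (closure {0<..<d / 2}) g"
      unfolding g_def using d(1) by (auto intro!: continuous_intros)
    moreover have "g t = 0" if "t \<in> {0<..<d / 2}" for t
      using mc(2)[OF in_ab[of t]] that by (simp add: g_def)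
    ultimately have "g 0 = 0"
      using continuous_constant_on_closure[of "{0<..<d / 2}" g 0 0] d(1) by auto
    then have "f (x + s * t) = 2 powi m * (x + s * t) + c" if "0 \<le> t" "t < d" for t
      using mc(2)[OF in_ab[of t]] that by (cases "t = 0") (auto simp: g_def)
    then have "?g (x + s * t) = 2 powi m * (x + s * t) + c" if "0 \<le> t" "t < d" for t
      using e0(2)[of t] d that by (simp add: extend_id_def)
    with mc(1) d(1) show ?thesis unfolding affine_germ_def by blast
  qed
  have "locally_PL ?g x" for x
  proof (cases "x \<in> {0..1}")
    case False
    then show ?thesis
      by (intro locally_PL_cong[OF locally_PL_id, of "max (- x) (x - 1)" x ?g])
        (auto simp: extend_id_def)
  next
    case x: True
    have id: "affine_germ (\<lambda>x. x) x s 0 0" for s by (rule affine_germI) auto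
    obtain m c where R: "affine_germ ?g x 1 m c"
    proof (cases "x < 1")
      case True
      with x have "\<exists>m c. affine_germ ?g x 1 m c" by (intro side[of x 1 "1 - x"]) auto
      with that show ?thesis by blast
    next
      case False
      with x have "x = 1" by simp
      then show ?thesis
        using that affine_germ_cong[OF id[of 1], of 1 ?g] out by auto
    qed
    obtain n d where L: "affine_germ ?g x (- 1) n d"
    proof (cases "0 < x")
      case True
      with x have "\<exists>m c. affine_germ ?g x (- 1) m c" by (intro side[of x "- 1" x]) auto
      with that show ?thesis by blast
    next
      case False
      with x have "x = 0" by simp
      then show ?thesis
        using that affine_germ_cong[OF id[of "- 1"], of 1 ?g] out by auto
    qed
    show ?thesis
    proof (cases "x \<in> dyadics")
      case True
      with L R show ?thesis by (auto simp: locally_PL_def)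
    next
      \<comment> \<open>A nondyadic point is not in \<open>B\<close>, so a full neighbourhood is
        affine and both germs have the same parameters.\<close>
      case nd: False
      then have "x \<noteq> 0" "x \<noteq> 1" by auto
      with x have "min x (1 - x) > 0" by auto
      then obtain d where d: "0 < d" "d \<le> min x (1 - x)" "\<And>y. y \<in> B \<Longrightarrow> \<bar>y - x\<bar> < d \<Longrightarrow> y = x"
        using finite_gap[OF B(1)] by metis
      have "y \<notin> B" if "\<bar>y - x\<bar> < d" for y using d(3) that nd B(2) by blast
      then have sub: "{x - d<..<x + d} \<subseteq> {0..1} - B" using d(2) by auto
      moreover have "x - d < x + d" "{x - d<..<x + d} \<subseteq> {0..1}" using sub d by auto
      ultimately obtain m c where mc: "c \<in> dyadics" "\<And>y. x - d < y \<Longrightarrow> y < x + d \<Longrightarrow> f y = 2 powi m * y + c"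
        using dyadic_affine[OF B(3)[OF sub] _ _ dy] by metis
      have "?g y = 2 powi m * y + c" if "\<bar>y - x\<bar> < d" for y
        using mc(2)[of y] that d(2) by (auto simp: extend_id_def)
      then have "affine_germ ?g x s m c" if "\<bar>s\<bar> = 1" for s
        using affine_germ_of_ball[OF mc(1) d(1)] that by blast
      from this[of 1] this[of "- 1"] show ?thesis by (auto simp: locally_PL_def)
    qed
  qed
  with bijg have "?g \<in> PL_homeos" by (intro PL_homeosI) auto
  with out show ?thesis by (auto simp: unit_PL_def)
qed

lemma carrier_thompson_F: "carrier thompson_F = (\<lambda>g. restrict g {0..1}) ` unit_PL"
proof
  show "carrier thompson_F \<subseteq> (\<lambda>g. restrict g {0..1}) ` unit_PL"
  proof
    fix f assume f: "f \<in> carrier thompson_F"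
    then have "f \<in> extensional {0..1}" by (auto simp: thompson_F_def Bij_def)
    then have "f = restrict (extend_id f) {0..1}"
      by (auto simp: extend_id_def extensional_def fun_eq_iff)
    with extend_F_in_unit_PL[OF f] show "f \<in> (\<lambda>g. restrict g {0..1}) ` unit_PL" by blast
  qed
qed (auto simp: restrict_unit_PL_in_F)

lemma thompson_F_Bij: "f \<in> carrier thompson_F \<Longrightarrow> f \<in> Bij {0..1}"
  by (simp add: thompson_F_def)

lemma mult_thompson_F:
  "f \<in> carrier thompson_F \<Longrightarrow> g \<in> carrier thompson_F \<Longrightarrow> f \<otimes>\<^bsub>thompson_F\<^esub> g = compose {0..1} f g"
  by (simp add: thompson_F_def BijGroup_def)

lemma one_thompson_F: "\<one>\<^bsub>thompson_F\<^esub> = (\<lambda>x\<in>{0..1}. x)"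
  by (simp add: thompson_F_def BijGroup_def)

lemma extend_id_one: "extend_id \<one>\<^bsub>thompson_F\<^esub> = id"
  by (auto simp: one_thompson_F extend_id_def)

lemma extend_id_mult:
  "f \<in> carrier thompson_F \<Longrightarrow> g \<in> carrier thompson_F \<Longrightarrow>
    extend_id (f \<otimes>\<^bsub>thompson_F\<^esub> g) = extend_id f \<circ> extend_id g"
  using Bij_imp_funcset[OF thompson_F_Bij, of g]
  by (fastforce simp: mult_thompson_F extend_id_def compose_def fun_eq_iff)

text \<open>This allows \<open>carrier_sum_group\<close> to be applied to the base of the wreath
  product. Closure is inherited from \<open>unit_PL\<close> by restricting total maps.\<close>

lemma group_thompson_F: "group thompson_F"
proof -
  interpret G: group "BijGroup {0..1::real}" by (rule group_BijGroup)
  let ?r = "\<lambda>g. restrict g {0..1::real}"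
  have "subgroup (carrier thompson_F) (BijGroup {0..1})"
  proof (rule G.subgroupI)
    show "carrier thompson_F \<subseteq> carrier (BijGroup {0..1})"
      by (auto simp: thompson_F_Bij BijGroup_def)
    show "carrier thompson_F \<noteq> {}"
      using PL_id by (auto simp: carrier_thompson_F unit_PL_def)
  next
    fix f assume f: "f \<in> carrier thompson_F"
    then obtain g where g: "g \<in> unit_PL" "f = ?r g" by (auto simp: carrier_thompson_F)
    have bij: "bij_betw f {0..1} {0..1}" using thompson_F_Bij[OF f] by (simp add: Bij_def)
    have "bij g" using g(1) by (simp add: unit_PL_def PL_homeosD)
    have "inv_into {0..1} f y = inv_into UNIV g y" if y: "y \<in> {0..1}" for y
    proof -
      obtain x where x: "x \<in> {0..1}" "y = f x" using bij y unfolding bij_betw_def by blast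
      then have "inv_into {0..1} f y = x" using bij by (auto simp: bij_betw_def)
      moreover have "inv_into UNIV g y = x"
        using x g(2) \<open>bij g\<close> by (auto intro: inv_f_eq simp: bij_is_inj)
      ultimately show ?thesis by simp
    qed
    then have "inv\<^bsub>BijGroup {0..1}\<^esub> f = ?r (inv_into UNIV g)"
      by (auto simp: inv_BijGroup[OF thompson_F_Bij[OF f]])
    then show "inv\<^bsub>BijGroup {0..1}\<^esub> f \<in> carrier thompson_F"
      using g by (auto simp: carrier_thompson_F unit_PL_inv)
  next
    fix f f' assume f: "f \<in> carrier thompson_F" "f' \<in> carrier thompson_F"
    then obtain g g' where g: "g \<in> unit_PL" "f = ?r g" "g' \<in> unit_PL" "f' = ?r g'"
      by (auto simp: carrier_thompson_F)
    have "f \<otimes>\<^bsub>BijGroup {0..1}\<^esub> f' = compose {0..1} f f'"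
      using f by (simp add: thompson_F_Bij BijGroup_def)
    also have "\<dots> = ?r (g \<circ> g')"
      using unit_PL_image[OF g(3)] by (auto simp: g compose_def fun_eq_iff)
    finally show "f \<otimes>\<^bsub>BijGroup {0..1}\<^esub> f' \<in> carrier thompson_F"
      using g by (auto simp: carrier_thompson_F unit_PL_compose)
  qed
  from G.subgroup_imp_group[OF this] show ?thesis
    by (simp add: thompson_F_def)
qed

section \<open>Periodic maps and Thompson's group T\<close>

lemma circle_proj_eq_iff: "circle_proj x = circle_proj y \<longleftrightarrow> x - y \<in> \<int>"
proof
  have "0 + x \<in> circle_proj x"
    unfolding circle_proj_def r_coset_def by (auto simp: additive_group_def)
  also assume "circle_proj x = circle_proj y"
  finally show "x - y \<in> \<int>" by (auto simp: circle_proj_def r_coset_def additive_group_def)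
next
  assume *: "x - y \<in> \<int>"
  have "circle_proj x = {z. z - x \<in> \<int>}" for x
    by (force simp: circle_proj_def r_coset_def additive_group_def)
  moreover have "z - x \<in> \<int> \<longleftrightarrow> z - y \<in> \<int>" for z
    using Ints_add[OF _ *, of "z - x"] Ints_diff[OF _ *, of "z - y"] by auto
  ultimately show "circle_proj x = circle_proj y" by simp
qed

definition periodic_PL :: "(real \<Rightarrow> real) set"
  where "periodic_PL = {g \<in> PL_homeos. \<forall>x. g (x + 1) = g x + 1}"

text \<open>The increment \<open>l\<close> is general because the lemma serves both lifts of circle
  homeomorphisms, with \<open>l = 1\<close>, and the maps
  \<open>periodic_extension l c\<close>.\<close>

lemma add_of_int_of_add_1:
  fixes g :: "real \<Rightarrow> real"
  assumes "\<And>x. g (x + 1) = g x + l"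
  shows "g (x + of_int k) = g x + l * of_int k"
proof (induction k rule: int_induct[where k = 0])
  case (step1 i)
  then show ?case using assms[of "x + of_int i"] by (simp add: algebra_simps)
next
  case (step2 i)
  then show ?case using assms[of "x + of_int i - 1"] by (simp add: algebra_simps)
qed simp

lemma periodic_PL_add_of_int: "g \<in> periodic_PL \<Longrightarrow> g (x + of_int k) = g x + of_int k"
  using add_of_int_of_add_1[of g 1 x k] by (simp add: periodic_PL_def)

lemma periodic_PL_add_Int: "g \<in> periodic_PL \<Longrightarrow> n \<in> \<int> \<Longrightarrow> g (x + n) = g x + n"
  by (auto elim!: Ints_cases simp: periodic_PL_add_of_int)

lemma periodic_PL_compose: "f \<in> periodic_PL \<Longrightarrow> g \<in> periodic_PL \<Longrightarrow> f \<circ> g \<in> periodic_PL"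
  by (auto simp: periodic_PL_def PL_compose)

lemma periodic_PL_inv:
  assumes "f \<in> periodic_PL"
  shows "inv_into UNIV f \<in> periodic_PL"
proof -
  have f: "inj f" "surj f" using assms by (auto simp: periodic_PL_def PL_homeosD bij_is_inj bij_is_surj)
  have "inv_into UNIV f (x + 1) = inv_into UNIV f x + 1" for x
    using f assms by (intro inv_f_eq) (auto simp: periodic_PL_def surj_f_inv_f)
  then show ?thesis using assms by (auto simp: periodic_PL_def PL_inv)
qed

section \<open>Circle maps induced by periodic lifts\<close>

text \<open>For a periodic \<open>g\<close> the chosen representative does not matter, by
  \<open>descend_circle_proj\<close>. The restriction to the carrier provides the extensionality
  that \<open>Bij\<close> asks for.\<close>

definition descend :: "(real \<Rightarrow> real) \<Rightarrow> real set \<Rightarrow> real set"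
  where "descend g = (\<lambda>p\<in>carrier real_mod_int. circle_proj (g (SOME x. circle_proj x = p)))"

lemma descend_circle_proj:
  assumes "g \<in> periodic_PL"
  shows "descend g (circle_proj x) = circle_proj (g x)"
proof -
  define y where "y = (SOME y. circle_proj y = circle_proj x)"
  have "circle_proj y = circle_proj x" unfolding y_def by (rule someI[of _ x]) simp
  then have "y - x \<in> \<int>" by (simp add: circle_proj_eq_iff)
  then have "g y - g x \<in> \<int>" using periodic_PL_add_Int[OF assms, of "y - x" x] by simp
  then have "circle_proj (g y) = circle_proj (g x)" by (simp add: circle_proj_eq_iff)
  then show ?thesis by (simp add: descend_def y_def carrier_real_mod_int)
qed

lemma descend_compose:
  assumes "f \<in> periodic_PL" "g \<in> periodic_PL"
  shows "descend (f \<circ> g) = compose (carrier real_mod_int) (descend f) (descend g)"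
proof
  fix p
  show "descend (f \<circ> g) p = compose (carrier real_mod_int) (descend f) (descend g) p"
  proof (cases "p \<in> carrier real_mod_int")
    case True
    then obtain x where "p = circle_proj x" by (auto simp: carrier_real_mod_int)
    with True show ?thesis
      by (simp add: compose_def descend_circle_proj assms periodic_PL_compose)
  qed (simp add: descend_def compose_def)
qed

lemma descend_eq_imp:
  assumes "f \<in> periodic_PL" "g \<in> periodic_PL" "descend f = descend g"
  shows "f x - g x \<in> \<int>"
  using descend_circle_proj[OF assms(1), of x] descend_circle_proj[OF assms(2), of x] assms(3)
  by (simp flip: circle_proj_eq_iff)

lemma descend_cong:
  assumes "\<And>x. f x - g x \<in> \<int>"
  shows "descend f = descend g"
proof -
  have "circle_proj (f x) = circle_proj (g x)" for x using assms by (simp add: circle_proj_eq_iff)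
  then show ?thesis by (simp add: descend_def)
qed

lemma continuous_descend:
  assumes "g \<in> periodic_PL"
  shows "continuous_map circle_topology circle_topology (descend g)"
proof (rule continuous_compose_quotient_map[OF quotient_map_circle_proj])
  have "continuous_map euclidean circle_topology (circle_proj \<circ> g)"
    using assms PL_continuous_on[of g UNIV] quotient_imp_continuous_map[OF quotient_map_circle_proj]
    by (intro continuous_map_compose) (auto simp: periodic_PL_def)
  moreover have "descend g \<circ> circle_proj = circle_proj \<circ> g"
    by (simp add: fun_eq_iff descend_circle_proj[OF assms])
  ultimately show "continuous_map euclidean circle_topology (descend g \<circ> circle_proj)" by simp
qed

text \<open>\<open>g\<close> itself is the required lift, and its inverse descends to the inverse
  map. The breakpoints in one period project to the finite set on the circle.\<close>

lemma descend_in_T: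
  assumes g: "g \<in> periodic_PL"
  shows "descend g \<in> carrier thompson_T"
proof -
  let ?C = "carrier real_mod_int"
  have PL: "g \<in> PL_homeos" using g by (simp add: periodic_PL_def)
  then have bij: "bij g" by (simp add: PL_homeosD)
  note ginv = periodic_PL_inv[OF g]
  have inv: "descend (inv_into UNIV g) (descend g p) = p"
    "descend g (descend (inv_into UNIV g) p) = p" if p: "p \<in> ?C" for p
  proof -
    obtain x where "p = circle_proj x" using p by (auto simp: carrier_real_mod_int)
    then show "descend (inv_into UNIV g) (descend g p) = p"
      "descend g (descend (inv_into UNIV g) p) = p"
      using bij by (auto simp: descend_circle_proj g ginv bij_is_inj bij_is_surj surj_f_inv_f)
  qed
  have "homeomorphic_maps circle_topology circle_topology (descend g) (descend (inv_into UNIV g))"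
    using continuous_descend[OF g] continuous_descend[OF ginv] inv
    by (auto simp: homeomorphic_maps_def topspace_circle_topology)
  then have homeo: "homeomorphic_map circle_topology circle_topology (descend g)"
    using homeomorphic_maps_map by blast
  have "bij_betw (descend g) ?C ?C"
    using homeomorphic_imp_injective_map[OF homeo]
      homeomorphic_imp_surjective_map[OF homeo]
    by (simp add: bij_betw_def topspace_circle_topology)
  moreover have "descend g \<in> extensional ?C" by (simp add: descend_def)
  ultimately have Bij: "descend g \<in> Bij ?C" by (simp add: Bij_def)
  obtain B where B: "finite B" "B \<subseteq> dyadics"
    "\<And>x. x \<in> {0..1} - B \<Longrightarrow> \<exists>m c. affine_near g x m c"
    using locally_PL_breakpoints[of g 0 1] PL by (auto simp: PL_homeosD)
  have near: "\<exists>m c. affine_near g x m c" if x: "circle_proj x \<notin> circle_proj ` B" for x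
  proof -
    have "circle_proj (frac x) = circle_proj x" by (simp add: circle_proj_eq_iff frac_def)
    with x have "frac x \<notin> B" by (metis imageI)
    then obtain m c e where e: "e > 0" "\<And>y. \<bar>y - frac x\<bar> < e \<Longrightarrow> g y = 2 powi m * y + c"
      using B(3)[of "frac x"] frac_ge_0[of x] frac_lt_1[of x]
      by (auto simp: affine_near_def less_imp_le)
    \<comment> \<open>Translating by the integer \<open>\<lfloor>x\<rfloor>\<close> moves the
      question into the unit interval; periodicity changes the intercept only.\<close>
    have "g y = 2 powi m * y + (c - 2 powi m * of_int \<lfloor>x\<rfloor> + of_int \<lfloor>x\<rfloor>)" if "\<bar>y - x\<bar> < e" for y
      using e(2)[of "y - of_int \<lfloor>x\<rfloor>"] that periodic_PL_add_of_int[OF g, of "y - of_int \<lfloor>x\<rfloor>" "\<lfloor>x\<rfloor>"]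
      by (simp add: frac_def algebra_simps)
    with e(1) show ?thesis unfolding affine_near_def by blast
  qed
  have "affine_pow2_on {a<..<b} g" if "circle_proj ` {a<..<b} \<inter> circle_proj ` B = {}" for a b
  proof (rule affine_near_interval, rule near)
    fix x assume "a < x" "x < b"
    then have "circle_proj x \<in> circle_proj ` {a<..<b}" by auto
    with that show "circle_proj x \<notin> circle_proj ` B" by blast
  qed
  then have "\<exists>B. finite B \<and> B \<subseteq> circle_proj ` dyadics \<and>
      (\<forall>a b. circle_proj ` {a<..<b} \<inter> B = {} \<longrightarrow> affine_pow2_on {a<..<b} g)"
    using B by (intro exI[of _ "circle_proj ` B"]) auto
  moreover have "descend g ` (circle_proj ` dyadics) \<subseteq> circle_proj ` dyadics"
    using PL_dyadic_iff[OF PL] by (auto simp: descend_circle_proj[OF g])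
  ultimately show ?thesis
    using Bij homeo PL_continuous_on[OF PL, of UNIV] PL_strict_mono[OF PL] descend_circle_proj[OF g]
    unfolding thompson_T_def by auto
qed

lemma mult_thompson_T:
  assumes "f \<in> periodic_PL" "g \<in> periodic_PL"
  shows "descend f \<otimes>\<^bsub>thompson_T\<^esub> descend g = descend (f \<circ> g)"
proof -
  have "descend f \<in> Bij (carrier real_mod_int)" "descend g \<in> Bij (carrier real_mod_int)"
    using descend_in_T assms by (auto simp: thompson_T_def)
  then show ?thesis by (simp add: descend_compose assms thompson_T_def BijGroup_def)
qed

section \<open>Equivariant extension from a unit cell\<close>

text \<open>A lift of a circle map of degree \<open>l\<close>, prescribed by \<open>c\<close> on the
  cell from 0 to 1.\<close>

definition periodic_extension :: "int \<Rightarrow> (real \<Rightarrow> real) \<Rightarrow> real \<Rightarrow> real"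
  where "periodic_extension l c x = of_int (l * \<lfloor>x\<rfloor>) + c (frac x)"

lemma periodic_extension_add_1: "periodic_extension l c (x + 1) = periodic_extension l c x + of_int l"
  by (simp add: periodic_extension_def frac_def algebra_simps)

lemma periodic_extension_unit: "0 \<le> x \<Longrightarrow> x < 1 \<Longrightarrow> periodic_extension l c x = c x"
  by (simp add: periodic_extension_def frac_eq[THEN iffD2] floor_eq_iff)

lemma periodic_extension_PL:
  assumes c: "c \<in> PL_homeos" "c 0 = 0" "c 1 = of_int l" and l: "l > 0"
  shows "periodic_extension l c \<in> PL_homeos"
proof (rule PL_homeosI)
  let ?p = "periodic_extension l c"
  \<comment> \<open>The total PL map that agrees with the extension on cell \<open>k\<close>. The
    conditions on \<open>c 0\<close> and \<open>c 1\<close> make neighbouring maps meet at the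
    integers.\<close>
  define q where "q k x = of_int (l * k) + c (x - of_int k)" for k :: int and x
  have q: "q k \<in> PL_homeos" for k
  proof -
    have "(\<lambda>y. y + of_int (l * k)) \<circ> (c \<circ> (\<lambda>x. x + of_int (- k))) \<in> PL_homeos"
      by (intro PL_compose PL_translation c dyadics_of_int)
    also have "(\<lambda>y. y + of_int (l * k)) \<circ> (c \<circ> (\<lambda>x. x + of_int (- k))) = q k"
      by (simp add: q_def fun_eq_iff)
    finally show ?thesis .
  qed
  have eq: "?p x = q k x" if "of_int k \<le> x" "x < of_int k + 1" for k x
  proof -
    have "\<lfloor>x\<rfloor> = k" using that by (simp add: floor_eq_iff)
    then show ?thesis by (simp add: periodic_extension_def q_def frac_def)
  qed
  show "locally_PL ?p x" for x
  proof (cases "x = of_int \<lfloor>x\<rfloor>")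
    case False
    then have "of_int \<lfloor>x\<rfloor> < x" using of_int_floor_le[of x] by linarith
    moreover have "x < of_int \<lfloor>x\<rfloor> + 1" by linarith
    ultimately have e: "0 < min (x - of_int \<lfloor>x\<rfloor>) (of_int \<lfloor>x\<rfloor> + 1 - x)" (is "0 < ?e")
      by simp
    have "?p y = q \<lfloor>x\<rfloor> y" if "\<bar>y - x\<bar> < ?e" for y
      using that by (intro eq) auto
    with e show ?thesis by (rule locally_PL_cong[OF PL_homeosD(2)[OF q]])
  next
    case True
    define k where "k = \<lfloor>x\<rfloor>"
    have x: "x = of_int k" using True by (simp add: k_def)
    have "?p y = q (k - 1) y" if "x - 1 < y" "y \<le> x" for y
    proof (cases "y = x")
      case True
      then show ?thesis using eq[of k x] c by (simp add: x q_def algebra_simps)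
    next
      case False
      then show ?thesis using that by (intro eq) (auto simp: x)
    qed
    moreover have "?p y = q k y" if "x \<le> y" "y < x + 1" for y
      using that by (intro eq) (auto simp: x)
    moreover have "x \<in> dyadics" by (simp add: x)
    ultimately show ?thesis
      using locally_PL_glue[of "q k" x "q (k - 1)" 1 ?p] PL_homeosD(2)[OF q[of k]]
        PL_homeosD(2)[OF q[of "k - 1"]] by simp
  qed
  then have "strict_mono ?p" by (rule locally_PL_imp_strict_mono)
  moreover have "\<exists>x. y = ?p x" for y
  proof -
    \<comment> \<open>The index of the block from \<open>l * k\<close> to \<open>l * (k + 1)\<close>
      that contains \<open>y\<close>; this block is the image of cell \<open>k\<close>.\<close>
    define k where "k = \<lfloor>y / of_int l\<rfloor>"
    have "of_int k \<le> y / of_int l" "y / of_int l < of_int k + 1" unfolding k_def by linarith+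
    then have k: "0 \<le> y - of_int (l * k)" "y - of_int (l * k) < of_int l"
      using l by (auto simp: field_simps)
    obtain z where z: "c z = y - of_int (l * k)"
      using PL_homeosD(1)[OF c(1)] bij_is_surj surjD by metis
    have "0 \<le> z" "z < 1"
      using k z c strict_mono_less_eq[OF PL_strict_mono[OF c(1)], of 0 z]
        strict_mono_less[OF PL_strict_mono[OF c(1)], of z 1] by auto
    then have "?p (of_int k + z) = y"
      using z eq[of k "of_int k + z"] by (simp add: q_def)
    then show ?thesis by blast
  qed
  then have "surj ?p" unfolding surj_def by (rule allI)
  ultimately show "bij ?p" by (simp add: bij_def strict_mono_imp_inj_on)
qed

section \<open>An action of the rationals on the line\<close>

text \<open>The slopes are 1, 2 and 4, with breakpoints chosen so that \<open>n + 1\<close> is mapped to \<open>n + 2\<close>.\<close>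

definition stretch_step :: "nat \<Rightarrow> real \<Rightarrow> real"
  where "stretch_step n x = (if x \<le> of_nat n + 3 / 4
    then (if x \<le> of_nat n + 1 / 2 then x else 2 * x - (of_nat n + 1 / 2))
    else 4 * x - (3 * of_nat n + 2))"

text \<open>Since slopes must be powers of two, the unit interval is stretched onto the interval
  from 0 to \<open>n + 1\<close> by moving the right end one unit at a time.\<close>

primrec stretch :: "nat \<Rightarrow> real \<Rightarrow> real"
  where
    "stretch 0 = id"
  | "stretch (Suc n) = stretch_step n \<circ> stretch n"

lemma dyadics_of_nat [simp]: "of_nat n \<in> dyadics"
  using dyadics_of_int[of "int n"] by simp

lemma dyadics_numeral [simp]: "numeral n \<in> dyadics"
  using dyadics_of_nat[of "numeral n"] by simp

lemma dyadics_mult_of_nat [simp]: "x \<in> dyadics \<Longrightarrow> of_nat n * x \<in> dyadics"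
  by (induction n) (auto simp: algebra_simps)

lemma stretch_step_PL: "stretch_step n \<in> PL_homeos"
proof -
  have quarter: "3 / 4 \<in> dyadics" using dyadics_powi[of 3 "- 2"] by (simp add: power_int_minus field_simps)
  have 1: "(\<lambda>x. 2 * x - (of_nat n + 1 / 2)) \<in> PL_homeos"
    using PL_affine[of "- (of_nat n + 1 / 2)" 1] by (simp add: algebra_simps)
  have 2: "(\<lambda>x. 4 * x - (3 * of_nat n + 2)) \<in> PL_homeos"
    using PL_affine[of "- (3 * of_nat n + 2)" 2] dyadics_mult_of_nat[of 3 n]
    by (simp add: power_int_def algebra_simps)
  show ?thesis
    unfolding stretch_step_def using quarter
    by (intro PL_glue PL_id 1 2) auto
qed

lemma stretch_PL: "stretch n \<in> PL_homeos"
  by (induction n) (simp_all only: stretch.simps PL_id PL_compose stretch_step_PL)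

text \<open>The part kept fixed here becomes the wandering interval.\<close>

lemma stretch_small: "x \<le> 1 / 2 \<Longrightarrow> stretch n x = x"
proof (induction n)
  case (Suc n)
  then have "x \<le> of_nat n + 1 / 2" using of_nat_0_le_iff[of n, where 'a = real] by linarith
  with Suc show ?case by (simp add: stretch_step_def)
qed simp

lemma stretch_1: "stretch n 1 = of_nat (Suc n)"
  by (induction n) (auto simp: stretch_step_def)

primrec uniformize :: "nat \<Rightarrow> real \<Rightarrow> real"
  where
    "uniformize 0 = id"
  | "uniformize (Suc n) = periodic_extension (int (Suc n)) (stretch n) \<circ> uniformize n"

lemma periodic_stretch_PL: "periodic_extension (int (Suc n)) (stretch n) \<in> PL_homeos"
  by (intro periodic_extension_PL) (auto simp: stretch_PL stretch_small stretch_1)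

lemma uniformize_PL: "uniformize n \<in> PL_homeos"
  by (induction n) (simp_all only: uniformize.simps PL_id PL_compose periodic_stretch_PL)

lemma uniformize_small: "0 \<le> x \<Longrightarrow> x \<le> 1 / 2 \<Longrightarrow> uniformize n x = x"
  by (induction n) (auto simp: periodic_extension_unit stretch_small)

section \<open>The conjugated translations and their compatibility\<close>

definition rat_action_at :: "nat \<Rightarrow> rat \<Rightarrow> real \<Rightarrow> real"
  where "rat_action_at n q = inv_into UNIV (uniformize n) \<circ>
    ((\<lambda>x. x + of_rat (q * fact n)) \<circ> uniformize n)"

text \<open>Every level that clears the denominator of \<open>q\<close> yields the same map, by
  \<open>rat_action_eq\<close>; the least one is merely a canonical choice, and several rationals
  can be compared at a common level.\<close>

definition rat_action :: "rat \<Rightarrow> real \<Rightarrow> real"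
  where "rat_action q = rat_action_at (LEAST n. q * fact n \<in> \<int>) q"

lemma uniformize_rat_action_at:
  "uniformize n (rat_action_at n q x) = uniformize n x + of_rat (q * fact n)"
  using PL_homeosD(1)[OF uniformize_PL, THEN bij_is_surj] by (simp add: rat_action_at_def surj_f_inv_f)

lemma rat_action_at_eqI:
  assumes "uniformize n y = uniformize n x + of_rat (q * fact n)"
  shows "rat_action_at n q x = y"
  using assms PL_homeosD(1)[OF uniformize_PL, THEN bij_is_inj]
  by (auto simp: rat_action_at_def intro: inv_f_eq)

lemma Ints_fact_mono:
  fixes q :: rat
  assumes "q * fact n \<in> \<int>" "n \<le> m"
  shows "q * fact m \<in> \<int>"
  using assms(2,1)
proof (induction m rule: dec_induct)
  case (step m)
  have "q * fact (Suc m) = of_nat (Suc m) * (q * fact m)" by simp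
  then show ?case using step by (metis Ints_mult Ints_of_nat)
qed

lemma ex_Ints_fact: "\<exists>n. (q :: rat) * fact n \<in> \<int>"
proof -
  obtain a b where q: "q = of_int a / of_int b" "b > 0"
    using quotient_of_div[of q] quotient_of_denom_pos' by (metis prod.collapse)
  have "nat b dvd fact (nat b)" using q(2) by (simp add: dvd_fact)
  then obtain k where "fact (nat b) = nat b * k" by blast
  then have "(fact (nat b) :: rat) = of_nat (nat b) * of_nat k"
    by (metis of_nat_fact of_nat_mult)
  then have "q * fact (nat b) = of_int (a * int k)"
    using q by simp
  then show ?thesis by (metis Ints_of_int)
qed

text \<open>If \<open>q * fact n\<close> is the integer \<open>k\<close>, the passage to the next
  level turns translation by \<open>k\<close> into translation by \<open>(n + 1) * k\<close>, which
  is exactly \<open>q * fact (n + 1)\<close>.\<close>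

lemma rat_action_at_Suc:
  assumes "q * fact n \<in> \<int>"
  shows "rat_action_at (Suc n) q = rat_action_at n q"
proof
  fix x
  obtain k where k: "q * fact n = of_int k" using assms by (auto elim: Ints_cases)
  let ?p = "periodic_extension (int (Suc n)) (stretch n)"
  have "?p (y + of_int k) = ?p y + of_int (int (Suc n)) * of_int k" for y
    by (rule add_of_int_of_add_1) (rule periodic_extension_add_1)
  moreover have "q * fact (Suc n) = of_int (int (Suc n) * k)"
    using k by (simp add: algebra_simps)
  ultimately show "rat_action_at (Suc n) q x = rat_action_at n q x"
    using uniformize_rat_action_at[of n q x] k
    by (intro rat_action_at_eqI) (simp add: of_rat_mult del: of_nat_Suc fact_Suc)
qed

lemma rat_action_eq:
  assumes "q * fact n \<in> \<int>"
  shows "rat_action q = rat_action_at n q"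
proof -
  define N where "N = (LEAST n. q * fact n \<in> \<int>)"
  have N: "q * fact N \<in> \<int>" unfolding N_def by (rule LeastI_ex) (rule ex_Ints_fact)
  have "N \<le> n" unfolding N_def using assms by (rule Least_le)
  then have "rat_action_at n q = rat_action_at N q"
  proof (induction n rule: dec_induct)
    case (step m)
    then show ?case using rat_action_at_Suc[OF Ints_fact_mono[OF N]] by simp
  qed simp
  then show ?thesis by (simp add: rat_action_def N_def)
qed

lemma rat_action_PL: "rat_action q \<in> PL_homeos"
proof -
  obtain n where n: "q * fact n \<in> \<int>" using ex_Ints_fact by blast
  then obtain k where "q * fact n = of_int k" by (auto elim: Ints_cases)
  then show ?thesis
    unfolding rat_action_eq[OF n] rat_action_at_def
    by (auto intro!: PL_compose PL_inv PL_translation uniformize_PL)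
qed

lemma rat_action_add: "rat_action (q + r) x = rat_action q (rat_action r x)"
proof -
  obtain n m where "q * fact n \<in> \<int>" "r * fact m \<in> \<int>" using ex_Ints_fact by meson
  then have N: "q * fact (max n m) \<in> \<int>" "r * fact (max n m) \<in> \<int>"
    by (auto elim: Ints_fact_mono)
  then have qr: "(q + r) * fact (max n m) \<in> \<int>" by (simp add: distrib_right)
  show ?thesis
    unfolding rat_action_eq[OF N(1)] rat_action_eq[OF N(2)] rat_action_eq[OF qr]
    by (intro rat_action_at_eqI) (simp add: uniformize_rat_action_at distrib_right of_rat_add)
qed

text \<open>Integers are admissible already at level 0, where \<open>uniformize\<close> is the
  identity.\<close>

lemma rat_action_of_int: "rat_action (of_int k) x = x + of_int k"
proof -
  have "rat_action (of_int k) = rat_action_at 0 (of_int k)" by (rule rat_action_eq) simp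
  then show ?thesis by (simp add: rat_action_at_eqI)
qed

lemma rat_action_0 [simp]: "rat_action 0 x = x"
  using rat_action_of_int[of 0] by simp

lemma rat_action_minus [simp]:
  "rat_action (- q) (rat_action q x) = x" "rat_action q (rat_action (- q) x) = x"
  by (simp_all flip: rat_action_add)

lemma rat_action_add_of_int: "rat_action (q + of_int k) x = rat_action q x + of_int k"
  by (metis add.commute rat_action_add rat_action_of_int)

lemma rat_action_periodic: "rat_action q \<in> periodic_PL"
  using rat_action_add[of q 1] rat_action_of_int[of 1] rat_action_add_of_int[of q 1]
  by (simp add: periodic_PL_def rat_action_PL)

text \<open>In the coordinate \<open>uniformize n\<close> the action of \<open>q\<close> is
  translation by an integer of size at least 1, while 0 and \<open>1 / 2\<close> are fixed by
  \<open>uniformize n\<close>. So a nonnegative point ends up at coordinate 1 or beyond.\<close>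

lemma rat_action_wandering:
  assumes "0 < q" "0 \<le> d"
  shows "1 / 2 < rat_action q d"
proof (rule ccontr)
  assume less: "\<not> 1 / 2 < rat_action q d"
  obtain n where n: "q * fact n \<in> \<int>" using ex_Ints_fact by blast
  then obtain k where k: "q * fact n = of_int k" by (auto elim: Ints_cases)
  moreover have "0 < q * fact n" using assms by simp
  ultimately have "1 \<le> k" by simp
  note mono = strict_mono_less_eq[OF PL_strict_mono[OF uniformize_PL]]
  have "uniformize n (rat_action q d) \<le> uniformize n (1 / 2)" using less by (simp add: mono)
  moreover have "uniformize n 0 \<le> uniformize n d" using assms by (simp add: mono)
  moreover have "uniformize n (rat_action q d) = uniformize n d + of_int k"
    by (simp add: rat_action_eq[OF n] uniformize_rat_action_at k)
  ultimately show False using \<open>1 \<le> k\<close> uniformize_small[of 0 n] uniformize_small[of "1 / 2" n] by simp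
qed

lemma rat_action_slots_disjoint:
  assumes "rat_action q d = rat_action r e" "d \<in> {0..<1/2}" "e \<in> {0..<1/2}"
  shows "q = r \<and> d = e"
proof -
  have *: False if "rat_action q d = rat_action r e" "d \<in> {0..<1/2}" "e \<in> {0..<1/2}" "q < r" for q r d e
  proof -
    have "d = rat_action (- q) (rat_action r e)" using that(1) by (metis rat_action_minus(1))
    then have "d = rat_action (r - q) e" by (simp flip: rat_action_add)
    then show False using rat_action_wandering[of "r - q" e] that by simp
  qed
  have "q = r" using *[OF assms(1-3)] *[OF assms(1)[symmetric] assms(3,2)]
    by (cases q r rule: linorder_cases) auto
  then show ?thesis using assms(1) by (metis rat_action_minus(1))
qed

section \<open>The embedding\<close>

text \<open>Applies \<open>a q\<close> in slot \<open>q\<close>, the translate of the half-open base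
  interval by \<open>q\<close>, after conjugation with the action. The label is unique by
  \<open>rat_action_slots_disjoint\<close>. Labels are rationals, not classes, because this works on
  the line.\<close>

definition slotwise :: "(rat \<Rightarrow> real \<Rightarrow> real) \<Rightarrow> real \<Rightarrow> real"
  where "slotwise a y =
    (if \<exists>q. \<exists>d\<in>{0..<1/2}. y = rat_action q d
     then let q = THE q. \<exists>d\<in>{0..<1/2}. y = rat_action q d
       in rat_action q (a q (rat_action (- q) y))
     else y)"

lemma slotwise_in:
  assumes "d \<in> {0..<1/2}"
  shows "slotwise a (rat_action q d) = rat_action q (a q d)"
proof -
  have "(THE r. \<exists>e\<in>{0..<1/2}. rat_action q d = rat_action r e) = q"
    using assms rat_action_slots_disjoint by (intro the_equality) blast+
  moreover have "\<exists>r. \<exists>e\<in>{0..<1/2}. rat_action q d = rat_action r e" using assms by blast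
  ultimately show ?thesis by (simp add: slotwise_def)
qed

lemma slotwise_out: "(\<And>q d. d \<in> {0..<1/2} \<Longrightarrow> y \<noteq> rat_action q d) \<Longrightarrow> slotwise a y = y"
  unfolding slotwise_def by (metis (no_types, lifting))

lemma slot_cases:
  obtains q d where "d \<in> {0..<1/2}" "y = rat_action q d"
  | "\<And>q d. d \<in> {0..<1/2} \<Longrightarrow> y \<noteq> rat_action q d"
  by blast

lemma slotwise_id: "slotwise (\<lambda>_. id) = id"
proof
  fix y show "slotwise (\<lambda>_. id) y = id y"
  proof (cases y rule: slot_cases)
    case (1 q d)
    then show ?thesis by (simp add: slotwise_in)
  next
    case 2
    then have "slotwise (\<lambda>_. id) y = y" by (rule slotwise_out)
    then show ?thesis by simp
  qed
qed

text \<open>Since \<open>b\<close> preserves the base interval, a point stays in its slot between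
  the two maps.\<close>

lemma slotwise_compose:
  assumes "\<And>q d. d \<in> {0..<1/2} \<Longrightarrow> b q d \<in> {0..<1/2}"
  shows "slotwise (\<lambda>q. a q \<circ> b q) = slotwise a \<circ> slotwise b"
proof
  fix y show "slotwise (\<lambda>q. a q \<circ> b q) y = (slotwise a \<circ> slotwise b) y"
  proof (cases y rule: slot_cases)
    case (1 q d)
    then show ?thesis using slotwise_in[OF assms[OF 1(1)]] by (simp add: slotwise_in)
  next
    case 2
    then have "slotwise c y = y" for c by (rule slotwise_out)
    then show ?thesis by simp
  qed
qed

text \<open>Moving an action past a slotwise map shifts the labels; this is the source of the shift
  in the wreath product.\<close>

lemma slotwise_rat_action:
  "slotwise a (rat_action r y) = rat_action r (slotwise (\<lambda>q. a (q + r)) y)"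
proof (cases y rule: slot_cases)
  case (1 q d)
  have "rat_action r y = rat_action (q + r) d" by (simp add: 1 rat_action_add add.commute[of q])
  then show ?thesis
    using 1 by (simp add: slotwise_in add.commute[of q] flip: rat_action_add)
next
  case 2
  have "rat_action r y \<noteq> rat_action q d" if "d \<in> {0..<1/2}" for q d
  proof
    assume "rat_action r y = rat_action q d"
    then have "y = rat_action (- r) (rat_action q d)" by (metis rat_action_minus(1))
    then have "y = rat_action (- r + q) d" by (simp only: rat_action_add)
    then show False using 2[OF that] by blast
  qed
  then have "slotwise a (rat_action r y) = rat_action r y" by (rule slotwise_out)
  moreover have "slotwise (\<lambda>q. a (q + r)) y = y" using 2 by (rule slotwise_out)
  ultimately show ?thesis by simp
qed

definition half_PL :: "(real \<Rightarrow> real) set"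
  where "half_PL = {h \<in> PL_homeos. \<forall>x. x \<le> 0 \<or> 1 / 2 \<le> x \<longrightarrow> h x = x}"

lemma half_PL_slot:
  assumes "h \<in> half_PL" "d \<in> {0..<1/2}"
  shows "h d \<in> {0..<1/2}"
proof -
  have "strict_mono h" and h: "h 0 = 0" "h (1/2) = 1/2"
    using assms(1) by (auto simp: half_PL_def PL_strict_mono)
  then show ?thesis
    using strict_mono_less_eq[of h 0 d] strict_mono_less[of h d "1/2"] assms(2) by simp
qed

text \<open>Integers act by translation, so their slots are the left halves of the unit cells. This
  identifies one class of slots with a map already known to be PL; the other classes are conjugates
  of it.\<close>

lemma slotwise_Ints:
  assumes h: "h \<in> half_PL"
  shows "slotwise (\<lambda>q. if q \<in> \<int> then h else id) = periodic_extension 1 h" (is "slotwise ?a = _")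
proof
  fix y
  show "slotwise ?a y = periodic_extension 1 h y"
  proof (cases "frac y < 1 / 2")
    case True
    have "y = rat_action (of_int \<lfloor>y\<rfloor>) (frac y)" by (simp add: rat_action_of_int frac_def)
    then have "slotwise ?a y = rat_action (of_int \<lfloor>y\<rfloor>) (h (frac y))"
      using True slotwise_in[of "frac y" ?a "of_int \<lfloor>y\<rfloor>"] by simp
    then show ?thesis by (simp add: rat_action_of_int periodic_extension_def)
  next
    case False
    then have "periodic_extension 1 h y = y"
      using h by (simp add: periodic_extension_def half_PL_def frac_def)
    moreover have "slotwise ?a y = y"
    proof (cases y rule: slot_cases)
      case (1 q d)
      have "q \<notin> \<int>"
      proof
        assume "q \<in> \<int>"
        then obtain k where "q = of_int k" by (auto elim: Ints_cases)
        then have y: "y = of_int k + d" using 1 by (simp add: rat_action_of_int)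
        then have "\<lfloor>y\<rfloor> = k" using 1(1) by (simp add: floor_eq_iff)
        then show False using False y 1(1) by (simp add: frac_def)
      qed
      then show ?thesis using 1 slotwise_in[OF 1(1), of ?a q] by simp
    next
      case 2
      then show ?thesis by (rule slotwise_out)
    qed
    ultimately show ?thesis by simp
  qed
qed

lemma slotwise_single:
  assumes h: "h \<in> half_PL"
  shows "slotwise (\<lambda>q. if q - r \<in> \<int> then h else id) \<in> periodic_PL" (is "slotwise ?a \<in> _")
proof -
  have "periodic_extension 1 h \<in> PL_homeos"
    using h by (intro periodic_extension_PL) (auto simp: half_PL_def)
  then have "periodic_extension 1 h \<in> periodic_PL"
    using periodic_extension_add_1[of 1 h] by (simp add: periodic_PL_def)
  then have "rat_action r \<circ> (periodic_extension 1 h \<circ> rat_action (- r)) \<in> periodic_PL"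
    by (intro periodic_PL_compose rat_action_periodic)
  also have "rat_action r \<circ> (periodic_extension 1 h \<circ> rat_action (- r)) = slotwise ?a"
  proof
    fix y
    show "(rat_action r \<circ> (periodic_extension 1 h \<circ> rat_action (- r))) y = slotwise ?a y"
      using slotwise_rat_action[of ?a r "rat_action (- r) y"] slotwise_Ints[OF h] by simp
  qed
  finally show ?thesis .
qed

text \<open>Piecewise linearity survives because only finitely many classes modulo the integers are
  moved: the map is a finite composite of single-class maps. This is where the restricted wreath
  product enters.\<close>

lemma slotwise_periodic:
  assumes "finite S" "\<And>q. a q \<in> half_PL" "\<And>q r. q - r \<in> \<int> \<Longrightarrow> a q = a r"
    "\<And>q. a q \<noteq> id \<Longrightarrow> \<exists>s\<in>S. q - s \<in> \<int>"
  shows "slotwise a \<in> periodic_PL"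
  using assms
proof (induction S arbitrary: a rule: finite_induct)
  case empty
  then have "a = (\<lambda>_. id)" by blast
  then have "slotwise a = id" by (simp only: slotwise_id)
  then show ?case by (simp add: periodic_PL_def PL_id)
next
  case (insert s S)
  \<comment> \<open>Erase the class of \<open>s\<close>; it is restored by composing with a
    single-class map.\<close>
  define b where "b q = (if q - s \<in> \<int> then id else a q)" for q
  have b: "b q \<in> half_PL" for q
    using insert.prems(1) PL_id by (auto simp: b_def half_PL_def)
  have "slotwise b \<in> periodic_PL"
  proof (rule insert.IH[OF b])
    fix q r :: rat assume qr: "q - r \<in> \<int>"
    have "q - s \<in> \<int> \<longleftrightarrow> r - s \<in> \<int>"
      using Ints_diff[OF _ qr, of "q - s"] Ints_add[OF _ qr, of "r - s"] by auto
    with qr show "b q = b r" using insert.prems(2) by (simp add: b_def)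
  next
    fix q assume "b q \<noteq> id"
    then have "q - s \<notin> \<int>" "a q \<noteq> id" by (auto simp: b_def split: if_splits)
    then show "\<exists>s\<in>S. q - s \<in> \<int>" using insert.prems(3) by blast
  qed
  moreover have "slotwise (\<lambda>q. if q - s \<in> \<int> then a s else id) \<in> periodic_PL"
    using insert.prems(1) by (rule slotwise_single)
  ultimately have "slotwise (\<lambda>q. if q - s \<in> \<int> then a s else id) \<circ> slotwise b \<in> periodic_PL"
    by (rule periodic_PL_compose[rotated])
  also have "slotwise (\<lambda>q. if q - s \<in> \<int> then a s else id) \<circ> slotwise b =
      slotwise (\<lambda>q. (if q - s \<in> \<int> then a s else id) \<circ> b q)"
    by (rule slotwise_compose[symmetric]) (rule half_PL_slot[OF b])
  also have "(\<lambda>q. (if q - s \<in> \<int> then a s else id) \<circ> b q) = a"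
    using insert.prems(2) by (auto simp: b_def fun_eq_iff)
  finally show ?case .
qed

text \<open>Conjugation by doubling, which brings the support from the unit interval into its left
  half.\<close>

definition halve :: "(real \<Rightarrow> real) \<Rightarrow> real \<Rightarrow> real"
  where "halve g x = g (2 * x) / 2"

lemma halve_compose: "halve (f \<circ> g) = halve f \<circ> halve g"
  by (simp add: halve_def fun_eq_iff)

lemma halve_id: "halve id = id"
  by (simp add: halve_def fun_eq_iff)

lemma halve_half_PL: "g \<in> unit_PL \<Longrightarrow> halve g \<in> half_PL"
proof -
  assume g: "g \<in> unit_PL"
  then have "(\<lambda>x. x / 2) \<circ> (g \<circ> (\<lambda>x. 2 * x)) \<in> PL_homeos"
    by (intro PL_compose PL_half PL_double) (simp add: unit_PL_def)
  also have "(\<lambda>x. x / 2) \<circ> (g \<circ> (\<lambda>x. 2 * x)) = halve g"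
    by (simp add: halve_def fun_eq_iff)
  finally have "halve g \<in> PL_homeos" .
  moreover have "halve g x = x" if "x \<le> 0 \<or> 1 / 2 \<le> x" for x
    using g that by (auto simp: unit_PL_def halve_def)
  ultimately show "halve g \<in> half_PL" unfolding half_PL_def by blast
qed

section \<open>Classes of rationals modulo the integers\<close>

definition rat_class :: "rat \<Rightarrow> rat set"
  where "rat_class q = \<int> #>\<^bsub>additive_group\<^esub> q"

lemma rat_class_eq: "rat_class q = {r. r - q \<in> \<int>}"
  by (force simp: rat_class_def r_coset_def additive_group_def)

lemma rat_class_eq_iff: "rat_class q = rat_class r \<longleftrightarrow> q - r \<in> \<int>"
proof
  assume "rat_class q = rat_class r"
  moreover have "q \<in> rat_class q" by (simp add: rat_class_eq)
  ultimately show "q - r \<in> \<int>" by (simp add: rat_class_eq)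
next
  assume *: "q - r \<in> \<int>"
  have "z - q \<in> \<int> \<longleftrightarrow> z - r \<in> \<int>" for z
    using Ints_add[OF _ *, of "z - q"] Ints_diff[OF _ *, of "z - r"] by auto
  then show "rat_class q = rat_class r" by (simp add: rat_class_eq)
qed

lemma carrier_rat_mod_int: "carrier rat_mod_int = range rat_class"
  by (auto simp: rat_mod_int_def FactGroup_def RCOSETS_def rat_class_def additive_group_def)

lemma mult_rat_class: "rat_class q \<otimes>\<^bsub>rat_mod_int\<^esub> rat_class r = rat_class (q + r)"
  using normal.rcos_sum[OF normal_Ints_additive_group, of q r]
  by (simp add: rat_mod_int_def FactGroup_def rat_class_def additive_group_def)

lemma one_rat_mod_int: "\<one>\<^bsub>rat_mod_int\<^esub> = rat_class 0"
  by (simp add: rat_mod_int_def FactGroup_def rat_class_eq)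

section \<open>The homomorphism attached to a subgroup of rational rotations\<close>

locale rational_rotations =
  fixes K :: "rat set set"
  assumes K: "subgroup K rat_mod_int"
begin

abbreviation "G \<equiv> rat_mod_int\<lparr>carrier := K\<rparr>"

lemma group_G: "group G"
  using group.subgroup_imp_group[OF group_rat_mod_int K] .

lemma K_cases:
  assumes "k \<in> K"
  obtains q where "k = rat_class q"
  using assms subgroup.subset[OF K] by (auto simp: carrier_rat_mod_int)

text \<open>An arbitrary section of the projection, in general not additive; its defect is an
  integer and disappears on the circle.\<close>

definition rep :: "rat set \<Rightarrow> rat"
  where "rep k = (SOME q. rat_class q = k)"

lemma rat_class_rep: "k \<in> K \<Longrightarrow> rat_class (rep k) = k"
  unfolding rep_def by (metis (mono_tags, lifting) K_cases someI_ex)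

lemma inv_rat_class:
  assumes "rat_class q \<in> K"
  shows "rat_class (- q) \<in> K" "inv\<^bsub>G\<^esub> (rat_class q) = rat_class (- q)"
proof -
  have "inv\<^bsub>rat_mod_int\<^esub> (rat_class q) = rat_class (- q)"
    by (rule group.inv_equality[OF group_rat_mod_int])
      (auto simp: carrier_rat_mod_int mult_rat_class one_rat_mod_int)
  then show in_K: "rat_class (- q) \<in> K" using subgroup.m_inv_closed[OF K assms] by simp
  show "inv\<^bsub>G\<^esub> (rat_class q) = rat_class (- q)"
    by (rule group.inv_equality[OF group_G])
      (auto simp: mult_rat_class one_rat_mod_int assms in_K)
qed

lemma rat_class_add_in_K: "rat_class q \<in> K \<Longrightarrow> rat_class r \<in> K \<Longrightarrow> rat_class (q + r) \<in> K"
  using subgroup.m_closed[OF K, of "rat_class q" "rat_class r"] by (simp add: mult_rat_class)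

text \<open>Pulls a base element back to rational labels. Slots whose class lies outside
  \<open>K\<close> are left alone.\<close>

definition coords :: "(rat set \<Rightarrow> real \<Rightarrow> real) \<Rightarrow> rat \<Rightarrow> real \<Rightarrow> real"
  where "coords x q = (if rat_class q \<in> K then halve (extend_id (x (rat_class q))) else id)"

definition embed :: "(rat set \<Rightarrow> real \<Rightarrow> real) \<times> rat set \<Rightarrow> real set \<Rightarrow> real set"
  where "embed = (\<lambda>(x, k). descend (slotwise (coords x) \<circ> rat_action (rep k)))"

abbreviation "base \<equiv> carrier (sum_group K (\<lambda>_. thompson_F))"

lemma base_eq: "base = {x \<in> (\<Pi>\<^sub>E k\<in>K. carrier thompson_F). finite {k \<in> K. x k \<noteq> \<one>\<^bsub>thompson_F\<^esub>}}"
  by (rule carrier_sum_group) (rule group_thompson_F)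

lemma coords_half_PL:
  assumes "x \<in> base"
  shows "coords x q \<in> half_PL"
proof (cases "rat_class q \<in> K")
  case True
  then have "x (rat_class q) \<in> carrier thompson_F" using assms by (auto simp: base_eq)
  with True show ?thesis by (simp add: coords_def halve_half_PL extend_F_in_unit_PL)
next
  case False
  then show ?thesis using PL_id by (simp add: coords_def half_PL_def)
qed

lemma slotwise_coords_periodic:
  assumes x: "x \<in> base"
  shows "slotwise (coords x) \<in> periodic_PL"
proof (rule slotwise_periodic)
  show "finite (rep ` {k \<in> K. x k \<noteq> \<one>\<^bsub>thompson_F\<^esub>})" using x by (simp add: base_eq)
  show "coords x q \<in> half_PL" for q using x by (rule coords_half_PL)
  show "coords x q = coords x r" if "q - r \<in> \<int>" for q r
    using that unfolding coords_def by (simp flip: rat_class_eq_iff)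
  show "\<exists>s\<in>rep ` {k \<in> K. x k \<noteq> \<one>\<^bsub>thompson_F\<^esub>}. q - s \<in> \<int>" if "coords x q \<noteq> id" for q
  proof -
    have k: "rat_class q \<in> K" using that by (auto simp: coords_def)
    have "x (rat_class q) \<noteq> \<one>\<^bsub>thompson_F\<^esub>"
      using that by (auto simp: coords_def extend_id_one halve_id)
    with k have "rep (rat_class q) \<in> rep ` {k \<in> K. x k \<noteq> \<one>\<^bsub>thompson_F\<^esub>}" by simp
    moreover have "q - rep (rat_class q) \<in> \<int>"
      using rat_class_rep[OF k] by (simp flip: rat_class_eq_iff)
    ultimately show ?thesis by blast
  qed
qed

lemma embed_in_T: "x \<in> base \<Longrightarrow> embed (x, k) \<in> carrier thompson_T"
  unfolding embed_def
  by (simp add: descend_in_T periodic_PL_compose slotwise_coords_periodic rat_action_periodic)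

text \<open>The inverse in \<open>shift_action\<close> turns into subtraction of
  \<open>rep k\<close> from the label. Outside \<open>K\<close> both labels \<open>q\<close> and
  \<open>q - rep k\<close> give the identity.\<close>

lemma coords_mult:
  assumes x: "x \<in> base" and y: "y \<in> base" and k: "k \<in> K"
  shows "coords (\<lambda>i\<in>K. x i \<otimes>\<^bsub>thompson_F\<^esub> shift_action G k y i) =
    (\<lambda>q. coords x q \<circ> coords y (q - rep k))"
proof
  fix q
  note rep = rat_class_rep[OF k]
  show "coords (\<lambda>i\<in>K. x i \<otimes>\<^bsub>thompson_F\<^esub> shift_action G k y i) q =
    coords x q \<circ> coords y (q - rep k)"
  proof (cases "rat_class q \<in> K")
    case True
    have inv: "rat_class (- rep k) \<in> K" "inv\<^bsub>G\<^esub> k = rat_class (- rep k)"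
      using inv_rat_class[of "rep k"] rep k by auto
    have K': "rat_class (q - rep k) \<in> K"
      using rat_class_add_in_K[OF True inv(1)] by simp
    have "shift_action G k y (rat_class q) = y (rat_class (q - rep k))"
      using True inv by (simp add: shift_action_def mult_rat_class)
    moreover have "x (rat_class q) \<in> carrier thompson_F" "y (rat_class (q - rep k)) \<in> carrier thompson_F"
      using True K' x y by (auto simp: base_eq)
    ultimately show ?thesis
      using True K' by (simp add: coords_def extend_id_mult halve_compose)
  next
    case False
    have "rat_class (q - rep k) \<notin> K"
    proof
      assume "rat_class (q - rep k) \<in> K"
      then have "rat_class (q - rep k + rep k) \<in> K"
        using rep k by (intro rat_class_add_in_K) auto
      with False show False by simp
    qed
    with False show ?thesis by (simp add: coords_def)
  qed
qed

text \<open>Moving the rotation by \<open>rep k\<close> past the second slotwise map shifts its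
  labels, which reproduces the multiplication of the semidirect product. The two lifts then differ
  by an integer translation only.\<close>

lemma embed_mult:
  assumes x: "x \<in> base" and y: "y \<in> base" and k: "k \<in> K" and l: "l \<in> K"
  shows "embed ((\<lambda>i\<in>K. x i \<otimes>\<^bsub>thompson_F\<^esub> shift_action G k y i), k \<otimes>\<^bsub>rat_mod_int\<^esub> l) =
    embed (x, k) \<otimes>\<^bsub>thompson_T\<^esub> embed (y, l)"
proof -
  let ?z = "\<lambda>i\<in>K. x i \<otimes>\<^bsub>thompson_F\<^esub> shift_action G k y i"
  let ?kl = "k \<otimes>\<^bsub>rat_mod_int\<^esub> l"
  let ?E = "\<lambda>x. slotwise (coords x)"
  have "?kl \<in> K" using subgroup.m_closed[OF K k l] .
  then have "rat_class (rep ?kl) = rat_class (rep k + rep l)"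
    using rat_class_rep k l by (simp flip: mult_rat_class)
  \<comment> \<open>The integer defect of \<open>rep\<close>; it is removed by
    \<open>descend_cong\<close>.\<close>
  then obtain n where n: "rep ?kl = rep k + rep l + of_int n"
    by (auto simp: rat_class_eq_iff elim!: Ints_cases) (metis add.commute diff_add_cancel)
  have E: "?E ?z = ?E x \<circ> slotwise (\<lambda>q. coords y (q - rep k))"
    unfolding coords_mult[OF x y k] by (rule slotwise_compose) (rule half_PL_slot[OF coords_half_PL[OF y]])
  have conj: "slotwise (\<lambda>q. coords y (q - rep k)) (rat_action (rep k) w) = rat_action (rep k) (?E y w)" for w
    by (simp add: slotwise_rat_action)
  define f where "f = (?E x \<circ> rat_action (rep k)) \<circ> (?E y \<circ> rat_action (rep l))"
  have f: "f \<in> periodic_PL"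
    unfolding f_def by (intro periodic_PL_compose slotwise_coords_periodic rat_action_periodic x y)
  have "(?E ?z \<circ> rat_action (rep ?kl)) w = f (w + of_int n)" for w
  proof -
    have "rat_action (rep ?kl) w = rat_action (rep k) (rat_action (rep l) (w + of_int n))"
      unfolding n rat_action_add_of_int periodic_PL_add_of_int[OF rat_action_periodic]
      by (simp only: rat_action_add)
    then show ?thesis by (simp add: E f_def conj)
  qed
  then have "(?E ?z \<circ> rat_action (rep ?kl)) w - f w \<in> \<int>" for w
    by (simp add: periodic_PL_add_of_int[OF f])
  then have "descend (?E ?z \<circ> rat_action (rep ?kl)) = descend f" by (rule descend_cong)
  then show ?thesis
    unfolding embed_def f_def
    by (simp add: mult_thompson_T periodic_PL_compose slotwise_coords_periodic rat_action_periodic x y)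
qed

text \<open>Lifts of the same circle map differ by integers pointwise. The image of the left end of
  a slot reveals the rotation, and the images of the other slot points reveal the
  coordinates.\<close>

lemma embed_inj:
  assumes x: "x \<in> base" and y: "y \<in> base" and k: "k \<in> K" and l: "l \<in> K"
    and eq: "embed (x, k) = embed (y, l)"
  shows "x = y \<and> k = l"
proof -
  define f where "f x k = slotwise (coords x) \<circ> rat_action (rep k)" for x k
  have diff: "f x k w - f y l w \<in> \<int>" for w
    using eq descend_eq_imp[of "f x k" "f y l"] x y
    by (auto simp: embed_def f_def periodic_PL_compose slotwise_coords_periodic rat_action_periodic)
  \<comment> \<open>A point of slot \<open>q - rep m\<close> is rotated into slot \<open>q\<close>,
    where the coordinate with label \<open>q\<close> acts.\<close>
  have f: "f z m (rat_action (q - rep m) d) = rat_action q (coords z q d)" if "d \<in> {0..<1/2}" for z m q d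
    using slotwise_in[OF that] by (simp add: f_def flip: rat_action_add)
  have coords: "coords z q d \<in> {0..<1/2}" if "z \<in> base" "d \<in> {0..<1/2}" for z q d
    using half_PL_slot[OF coords_half_PL] that by blast
  have zero: "coords z q 0 = 0" if "z \<in> base" for z q
    using coords_half_PL[OF that] by (simp add: half_PL_def)
  have "k = l"
  proof -
    have "f x k 0 = rat_action (rep k) 0" "f y l 0 = rat_action (rep l) 0"
      using f[of 0 x k "rep k"] f[of 0 y l "rep l"] zero x y by auto
    with diff[of 0] obtain n where "rat_action (rep k) 0 - rat_action (rep l) 0 = of_int n"
      by (auto elim: Ints_cases)
    then have "rat_action (rep k) 0 = rat_action (rep l + of_int n) 0"
      by (simp add: rat_action_add_of_int)
    then have "rep k = rep l + of_int n" using rat_action_slots_disjoint[of "rep k" 0] by simp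
    then have "rat_class (rep k) = rat_class (rep l)" by (simp add: rat_class_eq_iff)
    then show ?thesis using rat_class_rep k l by simp
  qed
  have eq_coords: "coords x q d = coords y q d" if d: "d \<in> {0..<1/2}" for q d
  proof -
    obtain n where "rat_action q (coords x q d) - rat_action q (coords y q d) = of_int n"
      using diff[of "rat_action (q - rep k) d"] f[OF d] \<open>k = l\<close> by (auto elim: Ints_cases)
    then have "rat_action q (coords x q d) = rat_action (q + of_int n) (coords y q d)"
      by (simp add: rat_action_add_of_int)
    \<comment> \<open>Disjointness of the slots forces \<open>n = 0\<close> and then equality of the
      coordinates.\<close>
    then show ?thesis using rat_action_slots_disjoint coords x y d by blast
  qed
  have "x p = y p" if p: "p \<in> K" for p
  proof -
    obtain q where q: "p = rat_class q" using K_cases[OF p] .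
    have F: "x p \<in> carrier thompson_F" "y p \<in> carrier thompson_F" using x y p by (auto simp: base_eq)
    have "x p t = y p t" if t: "t \<in> {0..1}" for t
    \<comment> \<open>After halving, \<open>t = 1\<close> is the missing right end of the half-open
      slot; there both elements of F take the value 1.\<close>
    proof (cases "t = 1")
      case True
      then show ?thesis
        using F[THEN extend_F_in_unit_PL] by (auto simp: unit_PL_def extend_id_def)
          (metis order_refl)
    next
      case False
      then show ?thesis
        using eq_coords[of "t / 2" q] t p by (auto simp: coords_def q halve_def extend_id_def)
    qed
    moreover have "x p \<in> extensional {0..1}" "y p \<in> extensional {0..1}"
      using F by (auto dest: thompson_F_Bij Bij_imp_extensional)
    ultimately show ?thesis by (rule extensionalityI[rotated 2])
  qed
  moreover have "x \<in> extensional K" "y \<in> extensional K" using x y by (auto simp: base_eq PiE_def)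
  ultimately have "x = y" by (intro extensionalityI[of x K y])
  with \<open>k = l\<close> show ?thesis by simp
qed

end

theorem theorem1p6:
  fixes K :: "rat set set"
  assumes "subgroup K rat_mod_int"
  shows "\<exists>\<Phi>. \<Phi> \<in> mon (restricted_wreath thompson_F (rat_mod_int\<lparr>carrier := K\<rparr>)) thompson_T"
proof
  interpret rational_rotations K by (rule rational_rotations.intro) (rule assms)
  have carrier: "carrier (restricted_wreath thompson_F G) = base \<times> K"
    by (simp add: restricted_wreath_def semidirect_product_def)
  have mult: "(x, k) \<otimes>\<^bsub>restricted_wreath thompson_F G\<^esub> (y, l) =
      ((\<lambda>i\<in>K. x i \<otimes>\<^bsub>thompson_F\<^esub> shift_action G k y i), k \<otimes>\<^bsub>rat_mod_int\<^esub> l)" for x y k l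
    by (simp add: restricted_wreath_def semidirect_product_def)
  show "embed \<in> mon (restricted_wreath thompson_F G) thompson_T"
    unfolding mon_def
  proof (intro CollectI conjI homI inj_onI)
    fix p assume "p \<in> carrier (restricted_wreath thompson_F G)"
    then show "embed p \<in> carrier thompson_T" by (auto simp: carrier embed_in_T)
  next
    fix p p'
    assume "p \<in> carrier (restricted_wreath thompson_F G)" "p' \<in> carrier (restricted_wreath thompson_F G)"
    then show "embed (p \<otimes>\<^bsub>restricted_wreath thompson_F G\<^esub> p') = embed p \<otimes>\<^bsub>thompson_T\<^esub> embed p'"
      by (auto simp: carrier mult embed_mult)
  next
    fix p p'
    assume "p \<in> carrier (restricted_wreath thompson_F G)" "p' \<in> carrier (restricted_wreath thompson_F G)"
      "embed p = embed p'"
    then show "p = p'" using embed_inj by (auto simp: carrier)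
  qed
qed

end
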